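(* Let $G$ be a finite abelian group of exponent $e$ and let $R$ be a commutative ring with unit equipped with a ring homomorphism $\mathbb{Z}[\zeta_e]\to R$. Let $M$ be a finite $R[G]$-module. Suppose $G=K_1\times\cdots\times K_r$, where each $K_i$ is a nontrivial cyclic group of $p_i$-power order, $p_1,\dots,p_r$ being (not necessarily distinct) primes. For $0\le i\le r-1$ let $G_i=K_1\times\cdots\times K_i$ ($G_0$ trivial), and for $1\le i\le r$ let $H_i$ be the unique subgroup of $K_i$ of order $p_i$. Assume that $\widehat{H}^0_{\chi}(H_i,M^{\psi})=0$ for all $\chi\in\widehat{H}_i$ and all $\psi\in\widehat{G}_{i-1}$, for $i=1,\dots,r$. Then $$[M]=\prod_{\psi\in\widehat{G}}[M^{\psi}]=\prod_{\psi\in\widehat{G}}[\varepsilon_\psi M].$$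
   Context: $[X]$ is the order of a finite set $X$; $\zeta_e$ a primitive complex $e$-th root of unity. For a subgroup $\Gamma\le G$, $\widehat\Gamma$ is the set of homomorphisms $\Gamma\to\mu_e\subset\mathbb{Z}[\zeta_e]^\times$, regarded as $R$-valued via the fixed homomorphism; products over $\widehat\Gamma$ are indexed by these $|\Gamma|$ characters. For $\chi\in\widehat\Gamma$ and an $R[\Gamma]$-module $N$: $N^\chi=\{m\in N:\sigma m=\chi(\sigma)m\ \forall\sigma\in\Gamma\}$, $\varepsilon_\chi=\sum_{\sigma\in\Gamma}\chi(\sigma)^{-1}\sigma$, $\widehat H^0_\chi(\Gamma,N)=N^\chi/\varepsilon_\chi N$. For $\psi\in\widehat G_{i-1}$, $M^\psi$ is the $\psi$-isotypic part for the $G_{i-1}$-action; it is $G$-stable and is regarded as an $R[H_i]$-module. *)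

theory Defs
  imports "HOL-Algebra.Algebra" "HOL-Algebra.Algebraic_Closure_Type"
begin

definition group_exponent :: "('g, 'b) monoid_scheme \<Rightarrow> nat" where
  "group_exponent G = (LEAST n. 0 < n \<and> (\<forall>x\<in>carrier G. x [^]\<^bsub>G\<^esub> n = \<one>\<^bsub>G\<^esub>))"

definition roots_of_unity :: "nat \<Rightarrow> complex monoid" where
  "roots_of_unity e = \<lparr>carrier = {z. z ^ e = 1}, monoid.mult = (*), one = 1\<rparr>"

definition primitive_root_of_unity :: "nat \<Rightarrow> complex \<Rightarrow> bool" where
  "primitive_root_of_unity e z \<longleftrightarrow> 0 < e \<and> z ^ e = 1 \<and> (\<forall>k. 0 < k \<and> k < e \<longrightarrow> z ^ k \<noteq> 1)"

definition int_adjoin :: "complex \<Rightarrow> complex ring" where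
  "int_adjoin z = ring_of_type_algebra\<lparr>carrier := generate_ring ring_of_type_algebra {z}\<rparr>"

text \<open>
  Characters are complex-valued, so that there are as many of them as elements of the group even
  when the homomorphism from the cyclotomic integers to the coefficient ring identifies some roots
  of unity.  They are taken extensional, so that equality is equality on the group.
\<close>

definition char_group :: "nat \<Rightarrow> ('g, 'b) monoid_scheme \<Rightarrow> ('g \<Rightarrow> complex) set" where
  "char_group e \<Gamma> = hom \<Gamma> (roots_of_unity e) \<inter> extensional (carrier \<Gamma>)"

text \<open>
  A formal sum of ring multiples of group elements is represented by its coefficient function, set
  to zero outside the group.  No finite-support condition is imposed, so this is the group ring for
  finite groups only.  For a subgroup \<open>\<Gamma>\<close> of \<open>G\<close>, the group ring of \<open>\<Gamma>\<close> is literally a subset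
  of that of \<open>G\<close>, and restriction of scalars leaves the record of a module unchanged.
\<close>

definition group_ring ::
    "('r, 'a) ring_scheme \<Rightarrow> ('g, 'b) monoid_scheme \<Rightarrow> ('g \<Rightarrow> 'r) ring" where
  "group_ring R \<Gamma> =
     \<lparr>carrier = {a. (\<forall>x\<in>carrier \<Gamma>. a x \<in> carrier R) \<and> (\<forall>x. x \<notin> carrier \<Gamma> \<longrightarrow> a x = \<zero>\<^bsub>R\<^esub>)},
      monoid.mult = (\<lambda>a b x. if x \<in> carrier \<Gamma>
                       then \<Oplus>\<^bsub>R\<^esub>y\<in>carrier \<Gamma>. a y \<otimes>\<^bsub>R\<^esub> b (inv\<^bsub>\<Gamma>\<^esub> y \<otimes>\<^bsub>\<Gamma>\<^esub> x) else \<zero>\<^bsub>R\<^esub>),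
      one = (\<lambda>x. if x = \<one>\<^bsub>\<Gamma>\<^esub> then \<one>\<^bsub>R\<^esub> else \<zero>\<^bsub>R\<^esub>),
      ring.zero = (\<lambda>x. \<zero>\<^bsub>R\<^esub>),
      ring.add = (\<lambda>a b x. a x \<oplus>\<^bsub>R\<^esub> b x)\<rparr>"

definition gr_single :: "('r, 'a) ring_scheme \<Rightarrow> 'r \<Rightarrow> 'g \<Rightarrow> 'g \<Rightarrow> 'r" where
  "gr_single R c \<sigma> = (\<lambda>x. if x = \<sigma> then c else \<zero>\<^bsub>R\<^esub>)"

text \<open>
  In what follows \<open>h\<close> is the homomorphism from the cyclotomic integers to \<open>R\<close> through which
  complex characters become \<open>R\<close>-valued.  \<open>N\<close> may be a module over \<open>group_ring R \<Gamma>\<close> or over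
  the group ring of a larger group, restricted to \<open>\<Gamma>\<close>.
\<close>

definition isotypic ::
    "('r, 'a) ring_scheme \<Rightarrow> (complex \<Rightarrow> 'r) \<Rightarrow> ('g, 'b) monoid_scheme \<Rightarrow> ('g \<Rightarrow> complex)
      \<Rightarrow> ('g \<Rightarrow> 'r, 'm, 'c) module_scheme \<Rightarrow> 'm set" where
  "isotypic R h \<Gamma> \<chi> N =
     {m \<in> carrier N. \<forall>\<sigma>\<in>carrier \<Gamma>.
        gr_single R \<one>\<^bsub>R\<^esub> \<sigma> \<odot>\<^bsub>N\<^esub> m = gr_single R (h (\<chi> \<sigma>)) \<one>\<^bsub>\<Gamma>\<^esub> \<odot>\<^bsub>N\<^esub> m}"

definition char_sum ::
    "('r, 'a) ring_scheme \<Rightarrow> (complex \<Rightarrow> 'r) \<Rightarrow> ('g, 'b) monoid_scheme \<Rightarrow> ('g \<Rightarrow> complex)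
      \<Rightarrow> 'g \<Rightarrow> 'r" where
  "char_sum R h \<Gamma> \<chi> =
     (\<Oplus>\<^bsub>group_ring R \<Gamma>\<^esub>\<sigma>\<in>carrier \<Gamma>. gr_single R (h (inverse (\<chi> \<sigma>))) \<sigma>)"

definition char_sum_image ::
    "('r, 'a) ring_scheme \<Rightarrow> (complex \<Rightarrow> 'r) \<Rightarrow> ('g, 'b) monoid_scheme \<Rightarrow> ('g \<Rightarrow> complex)
      \<Rightarrow> ('g \<Rightarrow> 'r, 'm, 'c) module_scheme \<Rightarrow> 'm set" where
  "char_sum_image R h \<Gamma> \<chi> N = (\<lambda>m. char_sum R h \<Gamma> \<chi> \<odot>\<^bsub>N\<^esub> m) ` carrier N"

definition tate_H0 ::
    "('r, 'a) ring_scheme \<Rightarrow> (complex \<Rightarrow> 'r) \<Rightarrow> ('g, 'b) monoid_scheme \<Rightarrow> ('g \<Rightarrow> complex)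
      \<Rightarrow> ('g \<Rightarrow> 'r, 'm, 'c) module_scheme \<Rightarrow> 'm set monoid" where
  "tate_H0 R h \<Gamma> \<chi> N =
     (N\<lparr>carrier := isotypic R h \<Gamma> \<chi> N\<rparr>) A_Mod (char_sum_image R h \<Gamma> \<chi> N)"

end

theory Submission
  imports Defs
begin

text \<open>
  For commuting endomorphisms \<open>a\<^sub>i\<close> of a finite module with product zero, if the kernel of each
  \<open>a\<^sub>i\<close> is the image of the product of the others, then the order of the module is the product of
  the orders of the kernels.  For a generator \<open>\<sigma>\<close> of a cyclic group of order \<open>m\<close> this applies to
  \<open>\<sigma> - w\<close>, \<open>w\<close> running over the \<open>m\<close>-th roots of unity: the kernel is an isotypic part, and the
  product of the other factors is the norm element of the corresponding character, up to a unit.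
  When \<open>m\<close> is a power of \<open>p\<close>, the condition on kernels descends to the subgroup of order \<open>p\<close>: there
  the Herbrand quotient of a finite module is 1, so \<open>H\<^sup>0 = 0\<close> gives both halves of exactness, and
  the passage back up loses only a factor that acts as \<open>p\<close> and is absorbed because the full norm
  acts as \<open>m\<close> on invariants.  Adding one cyclic factor at a time gives the general case, since the
  isotypic parts for the product are isotypic parts of isotypic parts.
\<close>

section \<open>Kernels and images of scalars on a finite module\<close>

text \<open>The isotypic parts need not form a direct sum, and this shapes the proof. The prime p
  may fail to be invertible in R, and \<open>h\<close> may identify roots of unity: for R = F_p, G
  cyclic of order p and M = F_p[G], all p characters have the same values in R and every M^\<psi> is
  the same subgroup of order p, yet the product of the orders is p^p = [M]. Orders are counted along
  a chain of kernels of partial products instead, which tolerates repeated and overlapping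
  eigenspaces. The factors are indexed by complex roots of unity, because the number of their images
  in R may be too small. Group elements, images of roots of unity and norm elements are all scalars
  from one commutative ring, the group ring. They therefore commute and preserve every isotypic
  part, and the counting can be done for scalars of an arbitrary module.\<close>

definition smult_ker :: "('a, 'm, 'c) module_scheme \<Rightarrow> 'a \<Rightarrow> 'm set" where
  "smult_ker M a = {x \<in> carrier M. a \<odot>\<^bsub>M\<^esub> x = \<zero>\<^bsub>M\<^esub>}"

definition smult_im :: "('a, 'm, 'c) module_scheme \<Rightarrow> 'a \<Rightarrow> 'm set" where
  "smult_im M a = (\<lambda>x. a \<odot>\<^bsub>M\<^esub> x) ` carrier M"

context module
begin

lemma smult_ker_add_subgroup:
  assumes "a \<in> carrier R"
  shows "subgroup (smult_ker M a) (add_monoid M)"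
  by (rule subgroup.intro)
    (auto simp: smult_ker_def assms smult_r_distr a_inv_def[symmetric] smult_r_minus)

lemma smult_minus_distr:
  assumes "a \<in> carrier R" "x \<in> carrier M" "y \<in> carrier M"
  shows "a \<odot>\<^bsub>M\<^esub> (x \<ominus>\<^bsub>M\<^esub> y) = a \<odot>\<^bsub>M\<^esub> x \<ominus>\<^bsub>M\<^esub> a \<odot>\<^bsub>M\<^esub> y"
  using assms by (simp add: a_minus_def smult_r_distr smult_r_minus)

lemma minus_smult_distr:
  assumes "a \<in> carrier R" "b \<in> carrier R" "x \<in> carrier M"
  shows "(a \<ominus> b) \<odot>\<^bsub>M\<^esub> x = a \<odot>\<^bsub>M\<^esub> x \<ominus>\<^bsub>M\<^esub> b \<odot>\<^bsub>M\<^esub> x"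
  using assms by (simp add: a_minus_def smult_l_distr smult_l_minus)

lemma minus_eq_zero_iff:
  assumes "x \<in> carrier M" "y \<in> carrier M"
  shows "x \<ominus>\<^bsub>M\<^esub> y = \<zero>\<^bsub>M\<^esub> \<longleftrightarrow> x = y"
  using assms by (metis M.minus_eq M.minus_minus M.minus_equality M.r_neg M.a_inv_closed)

lemma diff_mem_smult_ker_iff:
  assumes "a \<in> carrier R" "x \<in> carrier M" "y \<in> carrier M"
  shows "x \<ominus>\<^bsub>M\<^esub> y \<in> smult_ker M a \<longleftrightarrow> a \<odot>\<^bsub>M\<^esub> x = a \<odot>\<^bsub>M\<^esub> y"
  using assms by (simp add: smult_ker_def smult_minus_distr minus_eq_zero_iff)

lemma minus_add_cancel:
  assumes "x \<in> carrier M" "y \<in> carrier M"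
  shows "(x \<ominus>\<^bsub>M\<^esub> y) \<oplus>\<^bsub>M\<^esub> y = x"
  using assms by (simp add: a_minus_def M.a_assoc M.l_neg)

text \<open>The fibres of \<open>a\<close> on \<open>P\<close> are translates of its kernel. A
  general subgroup \<open>P\<close> is allowed because the induction below restricts a scalar to the
  kernel of a product.\<close>

lemma card_smult:
  assumes fin: "finite (carrier M)" and a: "a \<in> carrier R"
    and P: "subgroup P (add_monoid M)"
  shows "card P = card (P \<inter> smult_ker M a) * card ((\<lambda>x. a \<odot>\<^bsub>M\<^esub> x) ` P)"
proof -
  interpret P: subgroup P "add_monoid M" by (rule P)
  have sub: "P \<subseteq> carrier M" using P.subset by simp
  have finP: "finite P" using finite_subset[OF sub fin] .
  have add: "x \<oplus>\<^bsub>M\<^esub> y \<in> P" if "x \<in> P" "y \<in> P" for x y using P.m_closed that by simp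
  have diff: "x \<ominus>\<^bsub>M\<^esub> y \<in> P" if "x \<in> P" "y \<in> P" for x y
    using that P.m_inv_closed[of y] P.m_closed by (simp add: a_minus_def a_inv_def)
  have fib: "card {x \<in> P. a \<odot>\<^bsub>M\<^esub> x = y} = card (P \<inter> smult_ker M a)" if y: "y \<in> (\<lambda>x. a \<odot>\<^bsub>M\<^esub> x) ` P" for y
  proof -
    obtain x0 where x0: "x0 \<in> P" "y = a \<odot>\<^bsub>M\<^esub> x0" using y by blast
    then have x0M: "x0 \<in> carrier M" using sub by blast
    have "bij_betw (\<lambda>x. x \<oplus>\<^bsub>M\<^esub> x0) (P \<inter> smult_ker M a) {x \<in> P. a \<odot>\<^bsub>M\<^esub> x = y}"
    proof (rule bij_betw_byWitness[where f' = "\<lambda>x. x \<ominus>\<^bsub>M\<^esub> x0"])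
      show "\<forall>x\<in>P \<inter> smult_ker M a. (x \<oplus>\<^bsub>M\<^esub> x0) \<ominus>\<^bsub>M\<^esub> x0 = x"
        using x0M sub by (auto simp: a_minus_def M.a_assoc M.r_neg)
      show "\<forall>x\<in>{x \<in> P. a \<odot>\<^bsub>M\<^esub> x = y}. (x \<ominus>\<^bsub>M\<^esub> x0) \<oplus>\<^bsub>M\<^esub> x0 = x"
        using x0M sub minus_add_cancel by auto
      show "(\<lambda>x. x \<oplus>\<^bsub>M\<^esub> x0) ` (P \<inter> smult_ker M a) \<subseteq> {x \<in> P. a \<odot>\<^bsub>M\<^esub> x = y}"
      proof (intro image_subsetI)
        fix x assume x: "x \<in> P \<inter> smult_ker M a"
        then have "a \<odot>\<^bsub>M\<^esub> (x \<oplus>\<^bsub>M\<^esub> x0) = y"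
          using x0 x0M a by (simp add: smult_ker_def smult_r_distr)
        then show "x \<oplus>\<^bsub>M\<^esub> x0 \<in> {x \<in> P. a \<odot>\<^bsub>M\<^esub> x = y}" using x x0 add by blast
      qed
      show "(\<lambda>x. x \<ominus>\<^bsub>M\<^esub> x0) ` {x \<in> P. a \<odot>\<^bsub>M\<^esub> x = y} \<subseteq> P \<inter> smult_ker M a"
      proof (intro image_subsetI)
        fix x assume x: "x \<in> {x \<in> P. a \<odot>\<^bsub>M\<^esub> x = y}"
        then have "x \<in> carrier M" using sub by blast
        then have "x \<ominus>\<^bsub>M\<^esub> x0 \<in> smult_ker M a"
          using x x0 x0M a diff_mem_smult_ker_iff by simp
        then show "x \<ominus>\<^bsub>M\<^esub> x0 \<in> P \<inter> smult_ker M a" using x x0 diff by blast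
      qed
    qed
    then show ?thesis by (simp add: bij_betw_same_card)
  qed
  have "card P = (\<Sum>x\<in>P. 1)" by simp
  also have "\<dots> = (\<Sum>y\<in>(\<lambda>x. a \<odot>\<^bsub>M\<^esub> x) ` P. \<Sum>x\<in>{x \<in> P. a \<odot>\<^bsub>M\<^esub> x = y}. 1)"
    by (rule sum.image_gen[OF finP])
  also have "\<dots> = (\<Sum>y\<in>(\<lambda>x. a \<odot>\<^bsub>M\<^esub> x) ` P. card (P \<inter> smult_ker M a))"
    by (rule sum.cong) (simp_all add: fib)
  finally show ?thesis by (simp add: mult.commute)
qed

lemma card_smult_ker_im:
  assumes "finite (carrier M)" "a \<in> carrier R"
  shows "card (carrier M) = card (smult_ker M a) * card (smult_im M a)"
proof -
  have "carrier M \<inter> smult_ker M a = smult_ker M a" by (auto simp: smult_ker_def)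
  moreover have "subgroup (carrier M) (add_monoid M)"
    using M.add.subgroup_self by simp
  ultimately show ?thesis using card_smult[OF assms] by (simp add: smult_im_def)
qed

text \<open>
  The Herbrand quotient of a finite module is 1.
\<close>

lemma smult_exact_swap:
  assumes fin: "finite (carrier M)" and ab: "a \<in> carrier R" "b \<in> carrier R" "a \<otimes> b = \<zero>"
    and ker: "smult_ker M a \<subseteq> smult_im M b"
  shows "smult_ker M b \<subseteq> smult_im M a"
proof -
  have *: "smult_im M x \<subseteq> smult_ker M y"
    if "x \<in> carrier R" "y \<in> carrier R" "x \<otimes> y = \<zero>" for x y
    using that by (auto simp: smult_im_def smult_ker_def smult_assoc1[symmetric] R.m_comm)
  have eq: "smult_ker M a = smult_im M b" using ker *[of b a] ab by (auto simp: R.m_comm)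
  have finK: "finite (smult_ker M b)" using fin by (simp add: smult_ker_def)
  have "\<zero>\<^bsub>M\<^esub> \<in> smult_ker M a" using ab by (simp add: smult_ker_def)
  then have "card (smult_im M b) \<noteq> 0"
    using eq fin by (metis card_eq_0_iff empty_iff finite_imageI smult_im_def)
  \<comment> \<open>Both sides are the order of the module, rewritten with ker a = im b; the common
    factor is nonzero and cancels.\<close>
  moreover have "card (smult_im M b) * card (smult_im M a) = card (smult_im M b) * card (smult_ker M b)"
    using card_smult_ker_im[OF fin ab(1)] card_smult_ker_im[OF fin ab(2)] unfolding eq
    by (metis mult.commute)
  ultimately have "card (smult_im M a) = card (smult_ker M b)" by (metis mult_left_cancel)
  then have "smult_im M a = smult_ker M b"
    using card_subset_eq[OF finK *[of a b]] ab by simp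
  then show ?thesis by simp
qed

text \<open>Induction on a subset J with partial product A: a new factor b maps ker (b A) onto ker A
  with kernel ker b, so the orders multiply. Surjectivity needs more than the count, namely that ker
  A lies in the image of the complementary product, so this inclusion is carried along. At J = I the
  kernel is that of 0, the whole module.\<close>

lemma card_eq_prod_card_smult_ker:
  assumes fin: "finite (carrier M)" and I: "finite I" and a: "a \<in> I \<rightarrow> carrier R"
    and prod: "(\<Otimes>i\<in>I. a i) = \<zero>"
    and ker: "\<And>i. i \<in> I \<Longrightarrow> smult_ker M (a i) \<subseteq> smult_im M (\<Otimes>j\<in>I - {i}. a j)"
  shows "card (carrier M) = (\<Prod>i\<in>I. card (smult_ker M (a i)))"
proof -
  have "smult_ker M (\<Otimes>i\<in>J. a i) \<subseteq> smult_im M (\<Otimes>i\<in>I - J. a i) \<and>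
      card (smult_ker M (\<Otimes>i\<in>J. a i)) = (\<Prod>i\<in>J. card (smult_ker M (a i)))"
    if "finite J" "J \<subseteq> I" for J
    using that
  proof (induction J)
    case empty
    \<comment> \<open>The complement of the empty set is I, with product 0; the image of 0 contains
      the only element of the kernel of 1.\<close>
    have "smult_ker M \<one> = {\<zero>\<^bsub>M\<^esub>}" by (auto simp: smult_ker_def)
    moreover have "\<zero>\<^bsub>M\<^esub> \<in> smult_im M \<zero>" by (auto simp: smult_im_def image_iff intro!: bexI[of _ "\<zero>\<^bsub>M\<^esub>"])
    ultimately show ?case using prod by simp
  next
    case (insert k J)
    define A where "A = (\<Otimes>i\<in>J. a i)"
    define E where "E = (\<Otimes>i\<in>I - insert k J. a i)"
    define b where "b = a k"
    have k: "k \<in> I" "k \<notin> J" "J \<subseteq> I" using insert by auto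
    have cl: "A \<in> carrier R" "E \<in> carrier R" "b \<in> carrier R"
      using a k unfolding A_def E_def b_def by (auto intro!: R.finprod_closed)
    have AbJ: "(\<Otimes>i\<in>insert k J. a i) = b \<otimes> A"
      unfolding A_def b_def using insert a by (subst R.finprod_insert) auto
    have "(\<Otimes>i\<in>I - J. a i) = (\<Otimes>i\<in>insert k (I - insert k J). a i)"
      using k by (intro arg_cong[where f = "finprod R a"]) auto
    also have "\<dots> = b \<otimes> E"
      unfolding E_def b_def using I a k by (subst R.finprod_insert) auto
    finally have bE: "(\<Otimes>i\<in>I - J. a i) = b \<otimes> E" .
    have "(\<Otimes>i\<in>I - {k}. a i) = (\<Otimes>i\<in>J \<union> (I - insert k J). a i)"
      using k by (intro arg_cong[where f = "finprod R a"]) auto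
    also have "\<dots> = A \<otimes> E"
      unfolding A_def E_def using I insert a by (subst R.finprod_Un_disjoint) auto
    finally have AE: "smult_ker M b \<subseteq> smult_im M (A \<otimes> E)" using ker[OF k(1)] by (simp add: b_def)
    have IH1: "smult_ker M A \<subseteq> smult_im M (b \<otimes> E)"
      and IH2: "card (smult_ker M A) = (\<Prod>i\<in>J. card (smult_ker M (a i)))"
      using insert bE by (auto simp: A_def)
    have bk: "b \<odot>\<^bsub>M\<^esub> x \<in> smult_ker M A" if "x \<in> smult_ker M (b \<otimes> A)" for x
    proof -
      from that have x: "x \<in> carrier M" by (simp add: smult_ker_def)
      have "(A \<otimes> b) \<odot>\<^bsub>M\<^esub> x = \<zero>\<^bsub>M\<^esub>" using that cl by (simp add: smult_ker_def R.m_comm)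
      then show ?thesis using x cl by (simp add: smult_ker_def smult_assoc1)
    qed
    have 1: "smult_ker M (b \<otimes> A) \<subseteq> smult_im M E"
    proof
      fix x assume xk: "x \<in> smult_ker M (b \<otimes> A)"
      then have x: "x \<in> carrier M" by (simp add: smult_ker_def)
      \<comment> \<open>Two corrections: b x lies in ker A, so b x = b E y; then x - E y lies in ker
        b, so it equals A E z. Both E y and A E z are in the image of E.\<close>
      obtain y where y: "y \<in> carrier M" "b \<odot>\<^bsub>M\<^esub> x = (b \<otimes> E) \<odot>\<^bsub>M\<^esub> y"
        using bk[OF xk] IH1 by (auto simp: smult_im_def)
      then have "x \<ominus>\<^bsub>M\<^esub> E \<odot>\<^bsub>M\<^esub> y \<in> smult_ker M b"
        using cl x by (simp add: diff_mem_smult_ker_iff smult_assoc1)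
      then obtain z where z: "z \<in> carrier M" "x \<ominus>\<^bsub>M\<^esub> E \<odot>\<^bsub>M\<^esub> y = (E \<otimes> A) \<odot>\<^bsub>M\<^esub> z"
        using AE cl by (auto simp: smult_im_def R.m_comm)
      have "x = (x \<ominus>\<^bsub>M\<^esub> E \<odot>\<^bsub>M\<^esub> y) \<oplus>\<^bsub>M\<^esub> E \<odot>\<^bsub>M\<^esub> y"
        using minus_add_cancel x y cl by simp
      also have "\<dots> = E \<odot>\<^bsub>M\<^esub> (A \<odot>\<^bsub>M\<^esub> z \<oplus>\<^bsub>M\<^esub> y)"
        using z y cl by (simp add: smult_r_distr smult_assoc1)
      finally show "x \<in> smult_im M E" unfolding smult_im_def using z y cl by auto
    qed
    \<comment> \<open>The carried inclusion gives surjectivity: an element b E y of ker A has the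
      preimage E y, which lies in ker (b A).\<close>
    have im: "(\<lambda>x. b \<odot>\<^bsub>M\<^esub> x) ` smult_ker M (b \<otimes> A) = smult_ker M A"
    proof
      show "(\<lambda>x. b \<odot>\<^bsub>M\<^esub> x) ` smult_ker M (b \<otimes> A) \<subseteq> smult_ker M A" using bk by blast
      show "smult_ker M A \<subseteq> (\<lambda>x. b \<odot>\<^bsub>M\<^esub> x) ` smult_ker M (b \<otimes> A)"
      proof
        fix x assume xk: "x \<in> smult_ker M A"
        then obtain y where y: "y \<in> carrier M" "x = (b \<otimes> E) \<odot>\<^bsub>M\<^esub> y"
          using IH1 by (auto simp: smult_im_def)
        have xb: "x = b \<odot>\<^bsub>M\<^esub> (E \<odot>\<^bsub>M\<^esub> y)" using y cl by (simp add: smult_assoc1)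
        have "(A \<otimes> b) \<odot>\<^bsub>M\<^esub> (E \<odot>\<^bsub>M\<^esub> y) = \<zero>\<^bsub>M\<^esub>"
          using xk y cl by (simp add: smult_ker_def smult_assoc1)
        then have "E \<odot>\<^bsub>M\<^esub> y \<in> smult_ker M (b \<otimes> A)"
          using y cl by (simp add: smult_ker_def R.m_comm)
        then show "x \<in> (\<lambda>x. b \<odot>\<^bsub>M\<^esub> x) ` smult_ker M (b \<otimes> A)" using xb by blast
      qed
    qed
    have "smult_ker M (b \<otimes> A) \<inter> smult_ker M b = smult_ker M b"
    proof -
      have "smult_ker M b \<subseteq> smult_ker M (A \<otimes> b)"
        using cl by (auto simp: smult_ker_def smult_assoc1)
      then show ?thesis using cl by (auto simp: R.m_comm)
    qed
    then have "card (smult_ker M (b \<otimes> A)) = card (smult_ker M b) * card (smult_ker M A)"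
      using card_smult[OF fin cl(3) smult_ker_add_subgroup[of "b \<otimes> A"]] cl im by simp
    then show ?case using 1 AbJ IH2 insert by (simp add: E_def b_def)
  qed
  from this[OF I subset_refl] have "card (smult_ker M \<zero>) = (\<Prod>i\<in>I. card (smult_ker M (a i)))"
    using prod by simp
  moreover have "smult_ker M \<zero> = carrier M" by (auto simp: smult_ker_def)
  ultimately show ?thesis by simp
qed

end

section \<open>From the subgroup of order p to the cyclic p-group\<close>

text \<open>For a generator \<open>u\<close> of a cyclic group of order \<open>n\<close> this is the
  norm element; for a generator multiplied by an inverse root of unity it is the norm element of a
  character.\<close>

definition geom_sum :: "('a, 'b) ring_scheme \<Rightarrow> 'a \<Rightarrow> nat \<Rightarrow> 'a" where
  "geom_sum R u n = (\<Oplus>\<^bsub>R\<^esub>k\<in>{..<n}. u [^]\<^bsub>R\<^esub> k)"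

section \<open>Geometric sums in a commutative ring\<close>

context cring
begin

lemma geom_sum_closed [simp, intro]: "u \<in> carrier R \<Longrightarrow> geom_sum R u n \<in> carrier R"
  by (auto simp: geom_sum_def intro!: finsum_closed)

lemma geom_sum_0 [simp]: "geom_sum R u 0 = \<zero>"
  by (simp add: geom_sum_def)

lemma geom_sum_Suc:
  assumes "u \<in> carrier R"
  shows "geom_sum R u (Suc n) = u [^] n \<oplus> geom_sum R u n"
  unfolding geom_sum_def lessThan_Suc using assms by (subst finsum_insert) auto

lemma geom_sum_add:
  assumes u: "u \<in> carrier R"
  shows "geom_sum R u (m + n) = geom_sum R u m \<oplus> u [^] m \<otimes> geom_sum R u n"
proof (induction n)
  case (Suc n)
  then show ?case using u
    by (simp add: geom_sum_Suc nat_pow_mult[symmetric] r_distr a_ac)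
qed (use u in simp)

text \<open>Transitivity of norms: the exponents below \<open>m * n\<close> are the sums m i + j
  with i < n and j < m.\<close>

lemma geom_sum_mult:
  assumes u: "u \<in> carrier R"
  shows "geom_sum R u (m * n) = geom_sum R (u [^] m) n \<otimes> geom_sum R u m"
proof (induction n)
  case (Suc n)
  have "geom_sum R u (m * Suc n) = geom_sum R u (m * n) \<oplus> u [^] (m * n) \<otimes> geom_sum R u m"
    using geom_sum_add[OF u, of "m * n" m] by (simp add: add.commute)
  then show ?case using u Suc
    by (simp add: geom_sum_Suc nat_pow_pow l_distr a_comm)
qed (use u in simp)

lemma geom_sum_telescope:
  assumes u: "u \<in> carrier R"
  shows "(u \<ominus> \<one>) \<otimes> geom_sum R u n = u [^] n \<ominus> \<one>"
proof (induction n)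
  case (Suc n)
  have "(u \<ominus> \<one>) \<otimes> geom_sum R u (Suc n) = (u \<ominus> \<one>) \<otimes> u [^] n \<oplus> (u [^] n \<ominus> \<one>)"
    using u Suc by (simp add: geom_sum_Suc r_distr)
  also have "\<dots> = u [^] Suc n \<ominus> \<one>"
    unfolding nat_pow_Suc using u nat_pow_closed[OF u, of n] by algebra
  finally show ?case .
qed (use u in \<open>simp add: a_minus_def r_neg\<close>)

end

context module
begin

lemma smult_add_pow:
  assumes "a \<in> carrier R" "x \<in> carrier M"
  shows "a \<odot>\<^bsub>M\<^esub> ([(n::nat)] \<cdot>\<^bsub>M\<^esub> x) = [n] \<cdot>\<^bsub>M\<^esub> (a \<odot>\<^bsub>M\<^esub> x)"
  using assms by (induction n) (simp_all add: smult_r_distr)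

lemma geom_sum_smult_fixed:
  assumes u: "u \<in> carrier R" and x: "x \<in> carrier M" and fixed: "u \<odot>\<^bsub>M\<^esub> x = x"
  shows "geom_sum R u n \<odot>\<^bsub>M\<^esub> x = [n] \<cdot>\<^bsub>M\<^esub> x"
proof (induction n)
  case (Suc n)
  have "u [^] k \<odot>\<^bsub>M\<^esub> x = x" for k :: nat
    using u x by (induction k) (simp_all add: smult_assoc1 fixed)
  then show ?case using u x Suc by (simp add: R.geom_sum_Suc smult_l_distr M.add.nat_pow_comm M.a_comm)
qed (use x in simp)

lemma mem_smult_ker_minus_one:
  assumes "u \<in> carrier R"
  shows "x \<in> smult_ker M (u \<ominus> \<one>) \<longleftrightarrow> x \<in> carrier M \<and> u \<odot>\<^bsub>M\<^esub> x = x"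
  using assms by (auto simp: smult_ker_def minus_smult_distr minus_eq_zero_iff)

text \<open>
  With \<open>D = u - 1\<close> and \<open>B\<close>, \<open>C\<close> the geometric sums of \<open>u\<^sup>q\<close> and \<open>u\<close>, so that \<open>u\<^sup>q - 1 = DC\<close>, an
  element \<open>x\<close> of the kernel of \<open>D\<close> is some \<open>By\<close>; then \<open>Dy\<close> lies in the kernel of \<open>B\<close>, hence
  \<open>Dy = DCz\<close>, so that \<open>x = BCz + Bw\<close> with \<open>Dw = 0\<close>.  This is iterated until the error term
  \<open>B\<^sup>n w = p\<^sup>n w\<close> equals \<open>BCw\<close>.
\<close>

lemma smult_ker_minus_one_subset_im_geom_sum:
  fixes p k :: nat
  defines "q \<equiv> p ^ k"
  assumes fin: "finite (carrier M)" and u: "u \<in> carrier R" and upq: "u [^] (q * p) = \<one>"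
    and ker: "smult_ker M (u [^] q \<ominus> \<one>) \<subseteq> smult_im M (geom_sum R (u [^] q) p)"
  shows "smult_ker M (u \<ominus> \<one>) \<subseteq> smult_im M (geom_sum R u (q * p))"
proof -
  define D where "D = u \<ominus> \<one>"
  define C where "C = geom_sum R u q"
  define B where "B = geom_sum R (u [^] q) p"
  have cl: "D \<in> carrier R" "C \<in> carrier R" "B \<in> carrier R"
    using u by (auto simp: D_def C_def B_def)
  have DC: "u [^] q \<ominus> \<one> = D \<otimes> C" using R.geom_sum_telescope[OF u] by (simp add: D_def C_def)
  have BC: "geom_sum R u (q * p) = B \<otimes> C" using R.geom_sum_mult[OF u] by (simp add: B_def C_def)
  \<comment> \<open>The product is u^(qp) - 1 = 0, so D C and B annihilate each other and the
    inclusion \<open>ker\<close> can be swapped.\<close>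
  have "(D \<otimes> C) \<otimes> B = \<zero>"
    using R.geom_sum_telescope[of "u [^] q" p] u upq
    by (simp add: DC[symmetric] B_def R.nat_pow_pow R.minus_eq R.r_neg)
  then have kerB: "smult_ker M B \<subseteq> smult_im M (D \<otimes> C)"
    using smult_exact_swap[OF fin, of "D \<otimes> C" B] ker cl by (simp add: DC B_def)
  have fixed: "u \<odot>\<^bsub>M\<^esub> x = x" if "x \<in> smult_ker M D" for x
    using that u by (simp add: D_def mem_smult_ker_minus_one)
  have kerM: "x \<in> carrier M" if "x \<in> smult_ker M D" for x
    using that by (simp add: smult_ker_def)
  have step: "\<exists>z w. z \<in> carrier M \<and> w \<in> smult_ker M D \<and> x = (B \<otimes> C) \<odot>\<^bsub>M\<^esub> z \<oplus>\<^bsub>M\<^esub> B \<odot>\<^bsub>M\<^esub> w"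
    if x: "x \<in> smult_ker M D" for x
  proof -
    \<comment> \<open>A vector fixed by u is fixed by u^q, that is, ker D lies in the kernel of D C;
      the hypothesis then supplies a preimage under B.\<close>
    have "(C \<otimes> D) \<odot>\<^bsub>M\<^esub> x = \<zero>\<^bsub>M\<^esub>" using x cl by (simp add: smult_ker_def smult_assoc1)
    then have "x \<in> smult_ker M (D \<otimes> C)" using kerM[OF x] cl by (simp add: smult_ker_def R.m_comm)
    then obtain y where y: "y \<in> carrier M" "x = B \<odot>\<^bsub>M\<^esub> y"
      using ker by (auto simp: smult_im_def DC B_def)
    have "(D \<otimes> B) \<odot>\<^bsub>M\<^esub> y = \<zero>\<^bsub>M\<^esub>" using x y cl by (simp add: smult_ker_def smult_assoc1)
    then have "D \<odot>\<^bsub>M\<^esub> y \<in> smult_ker M B"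
      using y cl by (simp add: smult_ker_def smult_assoc1[symmetric] R.m_comm)
    then obtain z where z: "z \<in> carrier M" "D \<odot>\<^bsub>M\<^esub> y = (D \<otimes> C) \<odot>\<^bsub>M\<^esub> z"
      using kerB by (auto simp: smult_im_def)
    have w: "y \<ominus>\<^bsub>M\<^esub> C \<odot>\<^bsub>M\<^esub> z \<in> smult_ker M D"
      using y z cl by (simp add: diff_mem_smult_ker_iff smult_assoc1)
    have "x = B \<odot>\<^bsub>M\<^esub> ((y \<ominus>\<^bsub>M\<^esub> C \<odot>\<^bsub>M\<^esub> z) \<oplus>\<^bsub>M\<^esub> C \<odot>\<^bsub>M\<^esub> z)"
      using y z cl by (simp add: minus_add_cancel)
    also have "\<dots> = (B \<otimes> C) \<odot>\<^bsub>M\<^esub> z \<oplus>\<^bsub>M\<^esub> B \<odot>\<^bsub>M\<^esub> (y \<ominus>\<^bsub>M\<^esub> C \<odot>\<^bsub>M\<^esub> z)"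
      using y z cl kerM[OF w] by (simp add: smult_r_distr smult_assoc1 M.a_comm)
    finally show ?thesis using w z by blast
  qed
  have iter: "\<exists>z w. z \<in> carrier M \<and> w \<in> smult_ker M D \<and>
      x = (B \<otimes> C) \<odot>\<^bsub>M\<^esub> z \<oplus>\<^bsub>M\<^esub> B [^] j \<odot>\<^bsub>M\<^esub> w"
    if x: "x \<in> smult_ker M D" for x and j :: nat
  proof (induction j)
    case 0
    show ?case using x kerM[OF x] cl by (intro exI[of _ "\<zero>\<^bsub>M\<^esub>"] exI[of _ x]) simp
  next
    case (Suc j)
    then obtain z w where zw: "z \<in> carrier M" "w \<in> smult_ker M D"
      "x = (B \<otimes> C) \<odot>\<^bsub>M\<^esub> z \<oplus>\<^bsub>M\<^esub> B [^] j \<odot>\<^bsub>M\<^esub> w" by blast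
    obtain z' w' where zw': "z' \<in> carrier M" "w' \<in> smult_ker M D"
      "w = (B \<otimes> C) \<odot>\<^bsub>M\<^esub> z' \<oplus>\<^bsub>M\<^esub> B \<odot>\<^bsub>M\<^esub> w'" using step[OF zw(2)] by blast
    have Bj: "B [^] j \<in> carrier R" using cl by simp
    note w'M = kerM[OF zw'(2)]
    have comm: "B [^] j \<odot>\<^bsub>M\<^esub> ((B \<otimes> C) \<odot>\<^bsub>M\<^esub> z') = (B \<otimes> C) \<odot>\<^bsub>M\<^esub> (B [^] j \<odot>\<^bsub>M\<^esub> z')"
      using cl Bj zw'(1) by (simp add: smult_assoc1[symmetric] R.m_ac)
    have "x = (B \<otimes> C) \<odot>\<^bsub>M\<^esub> z \<oplus>\<^bsub>M\<^esub> (B [^] j \<odot>\<^bsub>M\<^esub> ((B \<otimes> C) \<odot>\<^bsub>M\<^esub> z') \<oplus>\<^bsub>M\<^esub> B [^] j \<odot>\<^bsub>M\<^esub> (B \<odot>\<^bsub>M\<^esub> w'))"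
      using zw(3) zw'(1) w'M cl Bj by (simp add: zw'(3) smult_r_distr)
    also have "\<dots> = (B \<otimes> C) \<odot>\<^bsub>M\<^esub> (z \<oplus>\<^bsub>M\<^esub> B [^] j \<odot>\<^bsub>M\<^esub> z') \<oplus>\<^bsub>M\<^esub> B [^] Suc j \<odot>\<^bsub>M\<^esub> w'"
      using zw(1) zw'(1) w'M cl Bj unfolding comm
      by (simp add: smult_r_distr smult_assoc1[of "B [^] j" B] M.a_assoc)
    finally show ?case using zw(1) zw'(1,2) Bj
      by (intro exI[of _ "z \<oplus>\<^bsub>M\<^esub> B [^] j \<odot>\<^bsub>M\<^esub> z'"] exI[of _ w']) simp
  qed
  have Bpow: "B [^] j \<odot>\<^bsub>M\<^esub> w = [(p ^ j)] \<cdot>\<^bsub>M\<^esub> w" if w: "w \<in> smult_ker M D" for w and j :: nat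
  proof (induction j)
    case (Suc j)
    have uq: "u [^] i \<odot>\<^bsub>M\<^esub> w = w" for i :: nat
      using u kerM[OF w] by (induction i) (simp_all add: smult_assoc1 fixed[OF w])
    have "B [^] Suc j \<odot>\<^bsub>M\<^esub> w = B [^] j \<odot>\<^bsub>M\<^esub> (B \<odot>\<^bsub>M\<^esub> w)"
      using cl kerM[OF w] by (simp add: smult_assoc1)
    also have "B \<odot>\<^bsub>M\<^esub> w = [p] \<cdot>\<^bsub>M\<^esub> w"
      unfolding B_def using u kerM[OF w] uq by (intro geom_sum_smult_fixed) simp_all
    finally show ?case using Suc cl kerM[OF w] M.add.nat_pow_pow[of w p "p ^ j"]
      by (simp add: smult_add_pow mult.commute)
  qed (use kerM[OF w] in simp)
  show ?thesis
  proof
    fix x assume "x \<in> smult_ker M (u \<ominus> \<one>)"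
    \<comment> \<open>After k + 1 rounds the error term is p^(k+1) w, and B C acts on the fixed
      vector w as p q, the same number.\<close>
    then obtain z w where zw: "z \<in> carrier M" "w \<in> smult_ker M D"
        "x = (B \<otimes> C) \<odot>\<^bsub>M\<^esub> z \<oplus>\<^bsub>M\<^esub> B [^] Suc k \<odot>\<^bsub>M\<^esub> w"
      using iter[of x "Suc k"] by (auto simp: D_def)
    note wM = kerM[OF zw(2)]
    have "(B \<otimes> C) \<odot>\<^bsub>M\<^esub> w = [p] \<cdot>\<^bsub>M\<^esub> ([q] \<cdot>\<^bsub>M\<^esub> w)"
      using cl wM Bpow[OF zw(2), of 1] geom_sum_smult_fixed[OF u wM fixed[OF zw(2)], of q]
      by (simp add: smult_assoc1 smult_add_pow C_def[symmetric] M.add.nat_pow_pow mult.commute)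
    also have "\<dots> = B [^] Suc k \<odot>\<^bsub>M\<^esub> w"
      using Bpow[OF zw(2), of "Suc k"] M.add.nat_pow_pow[OF wM, of p q]
      by (simp add: q_def mult.commute)
    finally have "x = (B \<otimes> C) \<odot>\<^bsub>M\<^esub> (z \<oplus>\<^bsub>M\<^esub> w)" using zw wM cl by (simp add: smult_r_distr)
    then show "x \<in> smult_im M (geom_sum R u (q * p))" using zw wM by (auto simp: BC smult_im_def)
  qed
qed

end

section \<open>Eigenspaces for roots of unity\<close>

text \<open>A homomorphism from a subring \<open>A\<close> of the complex numbers, written as a
  function on all complex numbers whose values outside \<open>A\<close> are arbitrary. Injectivity
  is not assumed, so differences of distinct roots of unity may map to 0.\<close>

locale ring_scalars = cring R for R (structure) +
  fixes A :: "complex set" and c :: "complex \<Rightarrow> 'a"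
  assumes one_mem: "1 \<in> A"
    and diff_mem: "\<lbrakk>a \<in> A; b \<in> A\<rbrakk> \<Longrightarrow> a - b \<in> A"
    and mult_mem: "\<lbrakk>a \<in> A; b \<in> A\<rbrakk> \<Longrightarrow> a * b \<in> A"
    and c_closed [simp, intro]: "a \<in> A \<Longrightarrow> c a \<in> carrier R"
    and c_one: "c 1 = \<one>"
    and c_diff: "\<lbrakk>a \<in> A; b \<in> A\<rbrakk> \<Longrightarrow> c (a - b) = c a \<ominus> c b"
    and c_mult: "\<lbrakk>a \<in> A; b \<in> A\<rbrakk> \<Longrightarrow> c (a * b) = c a \<otimes> c b"
begin

lemma zero_mem: "0 \<in> A"
  using diff_mem[OF one_mem one_mem] by simp

lemma c_zero: "c 0 = \<zero>"
  using c_diff[OF one_mem one_mem] by (simp add: c_one minus_eq r_neg)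

lemma power_mem: "a \<in> A \<Longrightarrow> a ^ n \<in> A"
  by (induction n) (auto simp: one_mem mult_mem)

lemma c_power: "a \<in> A \<Longrightarrow> c (a ^ n) = c a [^] n"
  by (induction n) (simp_all add: c_one c_mult power_mem m_comm)

text \<open>
  Evaluation of polynomials is needed only for coefficients in \<open>A\<close>; working with complex
  polynomials gives access to the factorisation of \<open>X\<^sup>m - 1\<close>.
\<close>

definition poly_ev :: "'a \<Rightarrow> complex poly \<Rightarrow> 'a" where
  "poly_ev s P = fold_coeffs (\<lambda>a v. c a \<oplus> s \<otimes> v) P \<zero>"

definition polys_over :: "complex poly set" where
  "polys_over = {P. range (Polynomial.coeff P) \<subseteq> A}"

lemma pCons_polys_over: "pCons a P \<in> polys_over \<longleftrightarrow> a \<in> A \<and> P \<in> polys_over"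
proof -
  have "range (Polynomial.coeff (pCons a P)) = insert a (range (Polynomial.coeff P))"
    by (auto simp: coeff_pCons image_iff split: nat.splits)
  then show ?thesis by (simp add: polys_over_def)
qed

lemma zero_polys_over: "0 \<in> polys_over"
  by (auto simp: polys_over_def zero_mem)

lemma poly_ev_0 [simp]: "poly_ev s 0 = \<zero>"
  by (simp add: poly_ev_def)

lemma poly_ev_pCons [simp]:
  assumes "s \<in> carrier R"
  shows "poly_ev s (pCons a P) = c a \<oplus> s \<otimes> poly_ev s P"
proof (cases "a = 0 \<and> P = 0")
  case True
  then show ?thesis using assms by (simp add: c_zero)
next
  case False
  then show ?thesis by (auto simp: poly_ev_def)
qed

lemma poly_ev_closed [simp, intro]:
  "\<lbrakk>s \<in> carrier R; P \<in> polys_over\<rbrakk> \<Longrightarrow> poly_ev s P \<in> carrier R"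
  by (induction P) (auto simp: pCons_polys_over)

lemma diff_smult_polys_over:
  assumes "P \<in> polys_over" "Q \<in> polys_over" "b \<in> A"
  shows "P - smult b Q \<in> polys_over"
  using assms by (auto simp: polys_over_def intro!: diff_mem mult_mem)

text \<open>Stands in for multiplicativity of evaluation: multiplication by X - w is a shift minus a
  scalar multiple (\<open>mult_linear_eq\<close>), and the shift is handled by
  \<open>poly_ev_pCons\<close>.\<close>

lemma poly_ev_diff_smult:
  assumes s: "s \<in> carrier R" and b: "b \<in> A"
  shows "\<lbrakk>P \<in> polys_over; Q \<in> polys_over\<rbrakk> \<Longrightarrow>
    poly_ev s (P - smult b Q) = poly_ev s P \<ominus> c b \<otimes> poly_ev s Q"
proof (induction P Q rule: poly_induct2)
  case 0
  then show ?case using b by (simp add: minus_eq)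
next
  case (pCons a P d Q)
  then have cl: "a \<in> A" "d \<in> A" "P \<in> polys_over" "Q \<in> polys_over"
    by (simp_all add: pCons_polys_over)
  define p q where "p = poly_ev s P" and "q = poly_ev s Q"
  have R: "c a \<in> carrier R" "c b \<in> carrier R" "c d \<in> carrier R" "p \<in> carrier R" "q \<in> carrier R"
    using cl b s by (auto simp: p_def q_def)
  have "poly_ev s (pCons a P - smult b (pCons d Q)) = (c a \<ominus> c b \<otimes> c d) \<oplus> s \<otimes> (p \<ominus> c b \<otimes> q)"
    using pCons.IH cl b s by (simp add: c_diff c_mult mult_mem p_def q_def)
  also have "\<dots> = (c a \<oplus> s \<otimes> p) \<ominus> c b \<otimes> (c d \<oplus> s \<otimes> q)" using R s by algebra
  finally show ?case using s by (simp add: p_def q_def)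
qed

lemma mult_linear_eq: "P * [:- w, 1:] = pCons 0 P - smult w P" for w :: complex
  by (simp add: mult_pCons_right)

lemma poly_ev_prod_linear:
  assumes s: "s \<in> carrier R" and W: "finite W" "W \<subseteq> A"
  shows "(\<Prod>w\<in>W. [:- w, 1:]) \<in> polys_over \<and>
    poly_ev s (\<Prod>w\<in>W. [:- w, 1:]) = (\<Otimes>w\<in>W. s \<ominus> c w)"
  using W
proof (induction W)
  case empty
  show ?case using s
    by (simp add: one_pCons pCons_polys_over one_mem zero_polys_over c_one)
next
  case (insert w W)
  define P where "P = (\<Prod>w\<in>W. [:- w, 1:])"
  have IH: "P \<in> polys_over" "poly_ev s P = (\<Otimes>w\<in>W. s \<ominus> c w)" and w: "w \<in> A"
    using insert by (auto simp: P_def)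
  have fac: "(\<Prod>w\<in>insert w W. [:- w, 1:]) = pCons 0 P - smult w P"
    using insert by (simp add: P_def mult.commute[of "[:- w, 1:]"] mult_linear_eq del: mult_pCons_left mult_pCons_right)
  have P0: "pCons 0 P \<in> polys_over" using IH by (simp add: pCons_polys_over zero_mem)
  have "poly_ev s (pCons 0 P - smult w P) = s \<otimes> poly_ev s P \<ominus> c w \<otimes> poly_ev s P"
    using s w IH(1) P0 by (simp add: poly_ev_diff_smult c_zero)
  also have "\<dots> = (s \<ominus> c w) \<otimes> poly_ev s P"
    using s w IH(1) poly_ev_closed[OF s IH(1)] c_closed[OF w] by algebra
  also have "\<dots> = (\<Otimes>w\<in>insert w W. s \<ominus> c w)"
    using insert s w unfolding IH(2) by (subst finprod_insert) (auto simp: Pi_def)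
  finally show ?case using fac diff_smult_polys_over[OF P0 IH(1) w] by simp
qed

end

section \<open>Linear factors of X^m - 1 over the complex numbers\<close>

lemma prod_roots_of_unity_linear:
  assumes "m > 0"
  shows "(\<Prod>w\<in>{w::complex. w ^ m = 1}. [:- w, 1:]) = monom 1 m - 1"
proof -
  let ?W = "{w::complex. w ^ m = 1}"
  have card: "card ?W = m" using assms by (simp add: card_roots_unity_eq)
  then have fin: "finite ?W" using assms by (metis card_ge_0_finite)
  have deg: "degree (\<Prod>w\<in>?W. [:- w, 1:]) = m"
    using card by (subst degree_prod_eq_sum_degree) auto
  have degm: "degree (monom (1::complex) m - 1) = m"
    using assms degree_add_eq_left[of "- 1 :: complex poly" "Polynomial.monom 1 m"]
    by (simp add: degree_monom_eq)
  have "lead_coeff (\<Prod>w\<in>?W. [:- w, 1:]) = 1" by (simp add: lead_coeff_prod)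
  moreover have "Polynomial.coeff (monom (1::complex) m - 1) m = 1"
    using assms by (simp add: coeff_1)
  moreover have "poly (\<Prod>w\<in>?W. [:- w, 1:]) w = poly (monom 1 m - 1) w" if "w \<in> ?W" for w
    using that fin by (auto simp: poly_prod poly_monom prod_zero_iff)
  \<comment> \<open>Equal degree and leading coefficient leave a difference of degree below m that
    vanishes at m points.\<close>
  ultimately show ?thesis
    using deg degm card by (intro poly_eqI_degree_lead_coeff[where n = m and A = ?W]) auto
qed

text \<open>The quotient of X^k - w^k by X - w, that is, the sum of w^(k-1-i) X^i over i < k, built
  coefficient by coefficient to match the recursion of \<open>poly_ev\<close>.\<close>

primrec geom_poly :: "complex \<Rightarrow> nat \<Rightarrow> complex poly" where
  "geom_poly w 0 = 0"
| "geom_poly w (Suc k) = pCons (w ^ k) (geom_poly w k)"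

lemma geom_poly_mult_linear: "geom_poly w k * [:- w, 1:] = monom 1 k - [:w ^ k:]"
proof (induction k)
  case (Suc k)
  have "geom_poly w (Suc k) * [:- w, 1:] = [:w ^ k:] * [:- w, 1:] + pCons 0 (geom_poly w k * [:- w, 1:])"
    by simp
  also have "\<dots> = monom 1 (Suc k) - [:w ^ Suc k:]"
    unfolding Suc by (simp add: monom_Suc)
  finally show ?case .
qed (simp add: one_pCons monom_0)

text \<open>The factor X - w is cancelled from two factorisations of X^m - 1. Complex polynomials
  form a domain, whereas \<open>s \<ominus> c w\<close> may be a zero divisor in R; hence the
  identity is proved here and only then evaluated.\<close>

lemma prod_other_roots_of_unity_linear:
  assumes "m > 0" "w ^ m = 1"
  shows "(\<Prod>v\<in>{v::complex. v ^ m = 1} - {w}. [:- v, 1:]) = geom_poly w m"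
proof -
  let ?W = "{v::complex. v ^ m = 1}"
  have "finite ?W" using assms by (simp add: finite_roots_unity)
  then have "[:- w, 1:] * (\<Prod>v\<in>?W - {w}. [:- v, 1:]) = [:- w, 1:] * geom_poly w m"
    using assms prod.remove[of ?W w "\<lambda>v. [:- v, 1:]"] prod_roots_of_unity_linear[OF assms(1)]
      geom_poly_mult_linear[of w m]
    by (simp add: mult.commute one_pCons del: mult_pCons_left mult_pCons_right)
  then show ?thesis by (metis mult_left_cancel pCons_eq_0_iff one_neq_zero)
qed

context ring_scalars
begin

text \<open>Multiplying the sum of w^(k-1-i) X^i by w gives w^k times the sum of (X / w)^i. The
  factor \<open>c w\<close> on the left avoids the exponent k - 1.\<close>

lemma poly_ev_geom_poly:
  assumes s: "s \<in> carrier R" and w: "w \<in> A" "inverse w \<in> A" "w \<noteq> 0"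
  shows "geom_poly w k \<in> polys_over \<and>
    c w \<otimes> poly_ev s (geom_poly w k) = c (w ^ k) \<otimes> geom_sum R (c (inverse w) \<otimes> s) k"
proof (induction k)
  case 0
  show ?case using w by (simp add: zero_polys_over c_one)
next
  case (Suc k)
  let ?u = "c (inverse w) \<otimes> s"
  have u: "?u \<in> carrier R" using s w by simp
  define g where "g = geom_sum R ?u k"
  define P where "P = poly_ev s (geom_poly w k)"
  have cl: "c w \<in> carrier R" "c (w ^ k) \<in> carrier R" "g \<in> carrier R" "P \<in> carrier R"
      "c (inverse w) \<in> carrier R"
    using u w s Suc by (auto simp: g_def P_def power_mem)
  have inv: "c w \<otimes> c (inverse w) = \<one>" using w by (simp add: c_mult[symmetric] c_one)
  have g': "geom_sum R ?u (Suc k) = \<one> \<oplus> ?u \<otimes> g"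
    using geom_sum_add[OF u, of 1 k] u by (simp add: geom_sum_Suc[OF u, of 0] g_def)
  have Suc_pow: "c (w ^ Suc k) = c w \<otimes> c (w ^ k)" using w by (simp add: c_mult power_mem)
  have "c (w ^ Suc k) \<otimes> (\<one> \<oplus> ?u \<otimes> g) = c w \<otimes> c (w ^ k) \<oplus> (c w \<otimes> c (inverse w)) \<otimes> (s \<otimes> (c (w ^ k) \<otimes> g))"
    unfolding Suc_pow using cl s by algebra
  also have "\<dots> = c w \<otimes> c (w ^ k) \<oplus> s \<otimes> (c w \<otimes> P)"
    using Suc.IH cl s by (simp add: inv g_def P_def)
  also have "\<dots> = c w \<otimes> (c (w ^ k) \<oplus> s \<otimes> P)" using cl s by algebra
  finally show ?case using Suc w s by (simp add: g' pCons_polys_over power_mem P_def)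
qed

text \<open>The link between the two languages: up to the unit \<open>c w\<close>, the twisted norm
  is the product of all the other linear factors. It is
  \<open>prod_other_roots_of_unity_linear\<close> evaluated at \<open>s\<close>, using w^m =
  1.\<close>

lemma geom_sum_eq_prod:
  assumes m: "m > 0" and W: "{w. w ^ m = 1} \<subseteq> A" and s: "s \<in> carrier R" and w: "w ^ m = 1"
  shows "geom_sum R (c (inverse w) \<otimes> s) m = c w \<otimes> (\<Otimes>v\<in>{v. v ^ m = 1} - {w}. s \<ominus> c v)"
proof -
  have iw: "inverse w ^ m = 1" using w by (simp add: power_inverse)
  have wA: "w \<in> A" "inverse w \<in> A" "w \<noteq> 0" using w iw W m by (auto simp: power_0_left)
  have fin: "finite ({v::complex. v ^ m = 1} - {w})" using m by (simp add: finite_roots_unity)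
  have "c w \<otimes> (\<Otimes>v\<in>{v. v ^ m = 1} - {w}. s \<ominus> c v) = c w \<otimes> poly_ev s (geom_poly w m)"
    using poly_ev_prod_linear[OF s fin] subset_trans[OF Diff_subset W]
      prod_other_roots_of_unity_linear[OF m w] by simp
  also have "\<dots> = geom_sum R (c (inverse w) \<otimes> s) m"
    using poly_ev_geom_poly[OF s wA, of m] s wA w by (simp add: c_one)
  finally show ?thesis by simp
qed

lemma prod_minus_roots_of_unity:
  assumes m: "m > 0" and W: "{w. w ^ m = 1} \<subseteq> A" and s: "s \<in> carrier R" "s [^] m = \<one>"
  shows "(\<Otimes>v\<in>{v. v ^ m = 1}. s \<ominus> c v) = \<zero>"
proof -
  let ?W = "{v::complex. v ^ m = 1}"
  have fin: "finite ?W" using m by (simp add: finite_roots_unity)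
  have one: "c 1 \<in> carrier R" using one_mem by simp
  \<comment> \<open>With v = 1 split off, the remaining product is the untwisted geometric sum, and
    telescoping gives s^m - 1 = 0.\<close>
  have "(\<Otimes>v\<in>?W. s \<ominus> c v) = (\<Otimes>v\<in>insert 1 (?W - {1}). s \<ominus> c v)"
    by (intro arg_cong[where f = "finprod R _"]) auto
  also have "\<dots> = (s \<ominus> c 1) \<otimes> (\<Otimes>v\<in>?W - {1}. s \<ominus> c v)"
    using fin W s by (subst finprod_insert) (auto simp: subset_eq one)
  also have "(\<Otimes>v\<in>?W - {1}. s \<ominus> c v) = geom_sum R s m"
    using geom_sum_eq_prod[OF m W s(1), of 1] s W fin by (simp add: c_one subset_eq Pi_def)
  finally show ?thesis using geom_sum_telescope[OF s(1), of m] s by (simp add: c_one minus_eq r_neg)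
qed

end

section \<open>Counting the eigenspaces of an element s with s^m = 1\<close>

locale module_scalars = module R M + ring_scalars R A c
  for R (structure) and M (structure) and A c
begin

text \<open>Each eigenvalue w is moved to 1 by replacing s with s / w, so the result on fixed
  vectors applies to every w separately; the kernels are then multiplied together by
  \<open>card_eq_prod_card_smult_ker\<close>.\<close>

lemma card_eq_prod_eigenspaces:
  fixes p k m :: nat
  assumes fin: "finite (carrier M)" and p: "p > 0" and m: "m = p ^ k * p"
    and W: "{w. w ^ m = 1} \<subseteq> A" and s: "s \<in> carrier R" "s [^] m = \<one>"
    and vanish: "\<And>w. w ^ p = 1 \<Longrightarrow>
      smult_ker M (s [^] (p ^ k) \<ominus> c w) \<subseteq> smult_im M (geom_sum R (c (inverse w) \<otimes> s [^] (p ^ k)) p)"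
  shows "card (carrier M) = (\<Prod>w\<in>{w. w ^ m = 1}. card (smult_ker M (s \<ominus> c w)))" (is ?card)
    and "\<And>w. w ^ m = 1 \<Longrightarrow> smult_ker M (s \<ominus> c w) = smult_im M (geom_sum R (c (inverse w) \<otimes> s) m)"
proof -
  let ?W = "{w::complex. w ^ m = 1}"
  have mpos: "m > 0" using p m by simp
  have finW: "finite ?W" using mpos by (simp add: finite_roots_unity)
  \<comment> \<open>Multiplication by the unit \<open>c (inverse w)\<close> turns eigenvectors for w
    into fixed vectors of the twisted element.\<close>
  have scale: "smult_ker M (t \<ominus> c w) = smult_ker M (c (inverse w) \<otimes> t \<ominus> \<one>)"
    if t: "t \<in> carrier R" and w: "w \<in> ?W" for t w
  proof -
    have iw: "inverse w ^ m = 1" using w by (simp add: power_inverse)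
    have wA: "w \<in> A" "inverse w \<in> A" "w \<noteq> 0" using w iw W mpos by (auto simp: power_0_left)
    have inv: "c w \<otimes> c (inverse w) = \<one>" using wA by (simp add: c_mult[symmetric] c_one)
    have "t \<odot>\<^bsub>M\<^esub> x = c w \<odot>\<^bsub>M\<^esub> x \<longleftrightarrow> (c (inverse w) \<otimes> t) \<odot>\<^bsub>M\<^esub> x = x" if x: "x \<in> carrier M" for x
    proof -
      have 1: "(c (inverse w) \<otimes> t) \<odot>\<^bsub>M\<^esub> x = c (inverse w) \<odot>\<^bsub>M\<^esub> (t \<odot>\<^bsub>M\<^esub> x)"
        using x t wA by (simp add: smult_assoc1)
      have 2: "c w \<odot>\<^bsub>M\<^esub> (c (inverse w) \<odot>\<^bsub>M\<^esub> y) = y" "c (inverse w) \<odot>\<^bsub>M\<^esub> (c w \<odot>\<^bsub>M\<^esub> y) = y"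
        if "y \<in> carrier M" for y
        using that wA inv by (simp_all add: smult_assoc1[symmetric] R.m_comm)
      show ?thesis using 1 2 x t wA by (metis smult_closed)
    qed
    then show ?thesis using t wA by (auto simp: smult_ker_def minus_smult_distr minus_eq_zero_iff)
  qed
  have ker: "smult_ker M (s \<ominus> c w) \<subseteq> smult_im M (geom_sum R (c (inverse w) \<otimes> s) m)"
    if w: "w \<in> ?W" for w
  proof -
    let ?v = "inverse w"
    have iw: "?v ^ m = 1" using w by (simp add: power_inverse)
    then have v: "?v \<in> A" using W by blast
    let ?u = "c ?v \<otimes> s"
    have u: "?u \<in> carrier R" using v s by simp
    have pow: "?u [^] n = c (?v ^ n) \<otimes> s [^] n" for n :: nat
      using v s by (simp add: nat_pow_distrib c_power)
    have um: "?u [^] (p ^ k * p) = \<one>" using pow[of m] iw s by (simp add: m[symmetric] c_one)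
    have wq: "(w ^ p ^ k) ^ p = 1" using w by (simp add: m power_mult)
    then have wqW: "w ^ p ^ k \<in> ?W" by (simp add: m power_mult) (metis power_mult mult.commute power_one)
    \<comment> \<open>The q-th power of the twist of s by w is the twist of s^q by w^q, where q =
      p^k. Hence \<open>vanish\<close> is used at the p-th root of unity w^q.\<close>
    have "smult_ker M (?u [^] (p ^ k) \<ominus> \<one>) \<subseteq> smult_im M (geom_sum R (?u [^] (p ^ k)) p)"
      using vanish[OF wq] scale[OF _ wqW, of "s [^] (p ^ k)"] s
      by (simp add: pow power_inverse)
    then have "smult_ker M (?u \<ominus> \<one>) \<subseteq> smult_im M (geom_sum R ?u m)"
      using smult_ker_minus_one_subset_im_geom_sum[OF fin u um] by (simp add: m)
    then show ?thesis using scale[OF s(1) w] by simp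
  qed
  have P: "(\<Otimes>v\<in>?W - {w}. s \<ominus> c v) \<in> carrier R" for w
    using s W by (auto intro!: finprod_closed)
  \<comment> \<open>The two scalars differ by the factor \<open>c w\<close>, which can be moved onto
    the vector.\<close>
  have "smult_im M (geom_sum R (c (inverse w) \<otimes> s) m) \<subseteq> smult_im M (\<Otimes>v\<in>?W - {w}. s \<ominus> c v)"
    if w: "w \<in> ?W" for w
    using geom_sum_eq_prod[OF mpos W s(1), of w] w W P
    by (auto simp: smult_im_def smult_assoc1 R.m_comm[of "c w"])
  then show ?card
    using ker W s finW
    by (intro card_eq_prod_card_smult_ker[OF fin finW _ prod_minus_roots_of_unity[OF mpos W s]]) blast+
  fix w :: complex assume w: "w ^ m = 1"
  let ?u = "c (inverse w) \<otimes> s"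
  have iw: "inverse w ^ m = 1" using w by (simp add: power_inverse)
  then have v: "inverse w \<in> A" using W by blast
  have u: "?u \<in> carrier R" using v s by simp
  have "?u [^] m = c (inverse w ^ m) \<otimes> s [^] m"
    using v s by (simp add: nat_pow_distrib c_power)
  then have um: "?u [^] m = \<one>" using iw s by (simp add: c_one)
  \<comment> \<open>The converse inclusion needs no vanishing: norms are fixed vectors because u^m =
    1.\<close>
  have "(?u \<ominus> \<one>) \<otimes> geom_sum R ?u m = \<zero>"
    using geom_sum_telescope[OF u, of m] um by (simp add: minus_eq r_neg)
  then have "smult_im M (geom_sum R ?u m) \<subseteq> smult_ker M (?u \<ominus> \<one>)"
    using u by (auto simp: smult_im_def smult_ker_def smult_assoc1[symmetric])
  then show "smult_ker M (s \<ominus> c w) = smult_im M (geom_sum R ?u m)"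
    using ker[of w] scale[OF s(1), of w] w by auto
qed

end

section \<open>Finite cyclic groups\<close>

lemma (in monoid) nat_pow_update_carrier [simp]: "x [^]\<^bsub>G\<lparr>carrier := B\<rparr>\<^esub> (n::nat) = x [^] n"
  by (rule nat_pow_consistent[symmetric])

text \<open>Cyclicity with a chosen generator, stated as a bijection from the exponents below
  \<open>m\<close>, so that sums over the group can be reindexed as geometric sums.\<close>

definition cyclic_enum :: "('g, 'b) monoid_scheme \<Rightarrow> 'g set \<Rightarrow> 'g \<Rightarrow> nat \<Rightarrow> bool" where
  "cyclic_enum G B g m \<longleftrightarrow> g \<in> carrier G \<and> 0 < m \<and> g [^]\<^bsub>G\<^esub> m = \<one>\<^bsub>G\<^esub> \<and>
     inj_on (\<lambda>k. g [^]\<^bsub>G\<^esub> k) {..<m} \<and> B = (\<lambda>k. g [^]\<^bsub>G\<^esub> k) ` {..<m}"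

context group
begin

lemma ex_cyclic_enum:
  assumes fin: "finite (carrier G)" and K: "subgroup K G"
    and cyc: "cyclic_group (G\<lparr>carrier := K\<rparr>)"
  shows "\<exists>g. cyclic_enum G K g (card K)"
proof -
  let ?K = "G\<lparr>carrier := K\<rparr>"
  interpret K: group ?K by (rule subgroup_imp_group[OF K])
  have sub: "K \<subseteq> carrier G" by (rule subgroup.subset[OF K])
  have finK: "finite (carrier ?K)" using finite_subset[OF sub fin] by simp
  obtain g where g: "g \<in> K" "subgroup_generated ?K {g} = ?K"
    using cyc by (auto simp: cyclic_group_def)
  then have gG: "g \<in> carrier G" using sub by blast
  have "K = generate ?K {g}"
    using g carrier_subgroup_generated[of ?K "{g}"] by simp
  also have "\<dots> = {g [^] k | k. k \<in> (UNIV :: nat set)}"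
    using K.generate_pow_on_finite_carrier[OF finK] g(1) by simp
  also have "\<dots> = {g [^] k | k. k \<in> {0..ord g - 1}}"
    by (rule ord_elems[OF fin gG])
  also have "{0..ord g - 1} = {..<ord g}" using ord_ge_1[OF fin gG] by auto
  finally have K_eq: "K = (\<lambda>k. g [^] k) ` {..<ord g}" by auto
  have inj: "inj_on (\<lambda>k. g [^] k) {..<ord g}"
    using ord_inj[OF gG] by (rule inj_on_subset) auto
  have "card K = ord g" using card_image[OF inj] K_eq by simp
  then show ?thesis
    using gG K_eq inj ord_ge_1[OF fin gG] pow_ord_eq_1[OF gG]
    unfolding cyclic_enum_def by (metis less_eq_Suc_le One_nat_def)
qed

lemma cyclic_enum_pow_mod:
  assumes "cyclic_enum G B g m"
  shows "g [^] (n::nat) = g [^] (n mod m)"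
proof -
  have g: "g \<in> carrier G" "g [^] m = \<one>" using assms by (auto simp: cyclic_enum_def)
  have "g [^] n = g [^] (m * (n div m) + n mod m)" by simp
  also have "\<dots> = (g [^] m) [^] (n div m) \<otimes> g [^] (n mod m)"
    using g(1) by (simp add: nat_pow_mult nat_pow_pow)
  finally show ?thesis using g by simp
qed

lemma cyclic_enum_pow_mem:
  assumes "cyclic_enum G B g m"
  shows "g [^] (n::nat) \<in> B"
proof -
  have "n mod m < m" using assms by (simp add: cyclic_enum_def)
  then show ?thesis
    using cyclic_enum_pow_mod[OF assms, of n] assms unfolding cyclic_enum_def by auto
qed

lemma cyclic_enum_pow_eq_iff:
  assumes "cyclic_enum G B g m"
  shows "g [^] (i::nat) = g [^] (j::nat) \<longleftrightarrow> i mod m = j mod m"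
proof -
  have "g [^] (i mod m) = g [^] (j mod m) \<longleftrightarrow> i mod m = j mod m"
    using assms unfolding cyclic_enum_def by (intro inj_on_eq_iff[of "\<lambda>k. g [^] k"]) auto
  then show ?thesis using cyclic_enum_pow_mod[OF assms] by metis
qed

lemma cyclic_enum_dvd:
  assumes "cyclic_enum G B g m" "g [^] (n::nat) = \<one>"
  shows "m dvd n"
  using cyclic_enum_pow_eq_iff[OF assms(1), of n 0] assms(2) by auto

text \<open>An element g^k of H is killed by p, so q p divides k p and q divides k. Thus H lies
  among the p powers of g^q, and counting gives equality.\<close>

lemma cyclic_enum_subgroup:
  assumes K: "cyclic_enum G K g (q * p)" and H: "subgroup H G" "H \<subseteq> K" "card H = p"
  shows "cyclic_enum G H (g [^] q) p"
proof -
  have g: "g \<in> carrier G" and pos: "0 < q" "0 < p" using K by (auto simp: cyclic_enum_def)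
  have pow: "(g [^] q) [^] (j::nat) = g [^] (q * j)" for j using g by (simp add: nat_pow_pow)
  have inj: "inj_on (\<lambda>j. (g [^] q) [^] j) {..<p}"
    unfolding pow by (rule inj_onI) (use pos in \<open>simp add: cyclic_enum_pow_eq_iff[OF K]\<close>)
  have sub: "H \<subseteq> (\<lambda>j. (g [^] q) [^] j) ` {..<p}"
  proof
    fix x assume x: "x \<in> H"
    then obtain k where k: "k < q * p" "x = g [^] k"
      using H(2) K by (auto simp: cyclic_enum_def)
    interpret H: group "G\<lparr>carrier := H\<rparr>" by (rule subgroup_imp_group[OF H(1)])
    have "x [^] p = \<one>" using H.pow_order_eq_1[of x] x H(3) by (simp add: Coset.order_def)
    then have "q * p dvd k * p" using cyclic_enum_dvd[OF K] k g by (simp add: nat_pow_pow)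
    then obtain j where "k = q * j" using pos by auto
    then show "x \<in> (\<lambda>j. (g [^] q) [^] j) ` {..<p}" using k pow by auto
  qed
  have "H = (\<lambda>j. (g [^] q) [^] j) ` {..<p}"
    by (rule card_subset_eq[OF _ sub]) (simp_all add: card_image[OF inj] H(3))
  then show ?thesis
    using g pos inj K by (simp add: cyclic_enum_def nat_pow_pow)
qed

end

section \<open>The group ring and its scalars\<close>

text \<open>Addition is pointwise and ignores the group law, so this holds for every \<Gamma>. It is
  applied to group rings of subgroups, where only sums are formed.\<close>

lemma group_ring_abelian_monoid:
  assumes "abelian_monoid R"
  shows "abelian_monoid (group_ring R \<Gamma>)"
proof -
  interpret abelian_monoid R by fact
  have "a x \<in> carrier R" if "a \<in> carrier (group_ring R \<Gamma>)" for a x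
    using that by (cases "x \<in> carrier \<Gamma>") (auto simp: group_ring_def)
  moreover have "(a \<oplus>\<^bsub>group_ring R \<Gamma>\<^esub> b) x = a x \<oplus>\<^bsub>R\<^esub> b x" "\<zero>\<^bsub>group_ring R \<Gamma>\<^esub> x = \<zero>\<^bsub>R\<^esub>" for a b x
    by (simp_all add: group_ring_def)
  ultimately show ?thesis
    by (intro abelian_monoidI) (auto simp: fun_eq_iff a_ac, auto simp: group_ring_def)
qed

text \<open>The value does not mention \<Gamma>. This identifies the sum in the group ring of a
  subgroup, as in \<open>char_sum\<close>, with the same sum in the group ring of G, where products
  and the module action live.\<close>

lemma finsum_gr_single:
  assumes R: "abelian_monoid R" and fin: "finite B" and B: "B \<subseteq> carrier \<Gamma>"
    and f: "f \<in> B \<rightarrow> carrier R"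
  shows "(\<Oplus>\<^bsub>group_ring R \<Gamma>\<^esub>\<sigma>\<in>B. gr_single R (f \<sigma>) \<sigma>) = (\<lambda>x. if x \<in> B then f x else \<zero>\<^bsub>R\<^esub>)"
proof -
  interpret R: abelian_monoid R by fact
  interpret S: abelian_monoid "group_ring R \<Gamma>" by (rule group_ring_abelian_monoid[OF R])
  show ?thesis using fin B f
  proof (induction B)
    case empty
    show ?case unfolding S.finsum_empty by (simp add: group_ring_def)
  next
    case (insert x B)
    have cl: "gr_single R (f y) y \<in> carrier (group_ring R \<Gamma>)" if "y \<in> insert x B" for y
      using insert.prems that by (auto simp: group_ring_def gr_single_def)
    have "(\<Oplus>\<^bsub>group_ring R \<Gamma>\<^esub>\<sigma>\<in>insert x B. gr_single R (f \<sigma>) \<sigma>)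
        = gr_single R (f x) x \<oplus>\<^bsub>group_ring R \<Gamma>\<^esub> (\<lambda>x. if x \<in> B then f x else \<zero>\<^bsub>R\<^esub>)"
      using insert cl by (subst S.finsum_insert) auto
    also have "\<dots> = (\<lambda>y. if y \<in> insert x B then f y else \<zero>\<^bsub>R\<^esub>)"
      using insert.hyps insert.prems by (auto simp: group_ring_def gr_single_def fun_eq_iff Pi_iff)
    finally show ?case .
  qed
qed

text \<open>The group ring enters as a commutative ring by assumption: a module over it, as in the
  theorem, already carries that fact.\<close>

locale group_ring_scalars = G?: comm_group G + R: cring R + S: cring "group_ring R G"
  for G :: "('g, 'b) monoid_scheme" (structure) and R :: "('r, 'a) ring_scheme" +
  fixes \<zeta> :: complex and h :: "complex \<Rightarrow> 'r" and e :: nat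
  assumes fin: "finite (carrier G)"
    and e: "e = group_exponent G"
    and prim: "primitive_root_of_unity e \<zeta>"
    and hom: "h \<in> ring_hom (int_adjoin \<zeta>) R"
begin

abbreviation S where "S \<equiv> group_ring R G"
abbreviation A where "A \<equiv> carrier (int_adjoin \<zeta>)"

definition act :: "'g \<Rightarrow> 'g \<Rightarrow> 'r" where "act \<sigma> = gr_single R \<one>\<^bsub>R\<^esub> \<sigma>"
definition sc :: "complex \<Rightarrow> 'g \<Rightarrow> 'r" where "sc z = gr_single R (h z) \<one>"

abbreviation iso_part where "iso_part B \<equiv> isotypic R h (G\<lparr>carrier := B\<rparr>)"
abbreviation chars where "chars B \<equiv> char_group e (G\<lparr>carrier := B\<rparr>)"
abbreviation norm_elt where "norm_elt B \<equiv> char_sum R h (G\<lparr>carrier := B\<rparr>)"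

lemma e_pos: "e > 0"
  using prim by (simp add: primitive_root_of_unity_def)

lemma pow_e:
  assumes "x \<in> carrier G"
  shows "x [^] e = \<one>"
proof -
  \<comment> \<open>The group order shows that the minimum defining the exponent is
    attained.\<close>
  have "0 < Coset.order G \<and> (\<forall>x\<in>carrier G. x [^] Coset.order G = \<one>)"
    using order_gt_0_iff_finite fin pow_order_eq_1 by blast
  then have "0 < group_exponent G \<and> (\<forall>x\<in>carrier G. x [^] group_exponent G = \<one>)"
    unfolding group_exponent_def by (rule LeastI)
  then show ?thesis using assms e by simp
qed

lemma A_closed:
  shows "1 \<in> A" "\<zeta> \<in> A" "\<lbrakk>a \<in> A; b \<in> A\<rbrakk> \<Longrightarrow> a + b \<in> A" "\<lbrakk>a \<in> A; b \<in> A\<rbrakk> \<Longrightarrow> a * b \<in> A"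
    "a \<in> A \<Longrightarrow> - a \<in> A"
proof -
  let ?C = "ring_of_type_algebra :: complex ring"
  interpret C: cring ?C by (rule cring_from_type_algebra)
  have A: "A = generate_ring ?C {\<zeta>}" by (simp add: int_adjoin_def)
  have ops: "x \<oplus>\<^bsub>?C\<^esub> y = x + y" "x \<otimes>\<^bsub>?C\<^esub> y = x * y" "\<one>\<^bsub>?C\<^esub> = 1" "\<zero>\<^bsub>?C\<^esub> = 0" "carrier ?C = UNIV" for x y
    by (simp_all add: ring_of_type_algebra_def)
  have minus: "\<ominus>\<^bsub>?C\<^esub> x = - x" for x
    using C.minus_equality[of "- x" x] by (simp add: ops)
  show "1 \<in> A" "\<zeta> \<in> A" using generate_ring.one[of ?C] generate_ring.incl[of \<zeta>] by (auto simp: A ops)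
  show "\<lbrakk>a \<in> A; b \<in> A\<rbrakk> \<Longrightarrow> a + b \<in> A" using generate_ring.eng_add[of a ?C "{\<zeta>}" b] by (simp add: A ops)
  show "\<lbrakk>a \<in> A; b \<in> A\<rbrakk> \<Longrightarrow> a * b \<in> A" using generate_ring.eng_mult[of a ?C "{\<zeta>}" b] by (simp add: A ops)
  show "a \<in> A \<Longrightarrow> - a \<in> A" using generate_ring.a_inv[of a ?C "{\<zeta>}"] by (simp add: A minus)
qed

lemma A_power: "a \<in> A \<Longrightarrow> a ^ n \<in> A"
  by (induction n) (auto intro: A_closed)

text \<open>The e powers of \<zeta> are distinct and there are only e roots, so every root is such a
  power. This places all character values in the domain of \<open>h\<close>.\<close>

lemma root_of_unity_mem:
  assumes "w ^ e = 1"
  shows "w \<in> A"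
proof -
  have z: "\<zeta> ^ e = 1" "\<zeta> \<noteq> 0" and min: "\<And>k. \<lbrakk>0 < k; k < e\<rbrakk> \<Longrightarrow> \<zeta> ^ k \<noteq> 1"
    using prim by (auto simp: primitive_root_of_unity_def power_0_left)
  have *: False if ij: "i < j" "j < e" "\<zeta> ^ i = \<zeta> ^ j" for i j
  proof -
    have "\<zeta> ^ j = \<zeta> ^ i * \<zeta> ^ (j - i)"
      using ij(1) by (metis le_add_diff_inverse less_imp_le power_add)
    then have "\<zeta> ^ (j - i) = 1" using ij z by simp
    then show False using min[of "j - i"] ij by simp
  qed
  have inj: "inj_on (\<lambda>k. \<zeta> ^ k) {..<e}"
    by (rule inj_onI) (metis * lessThan_iff nat_neq_iff)
  have "(\<lambda>k. \<zeta> ^ k) ` {..<e} = {w. w ^ e = 1}"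
  proof (rule card_subset_eq)
    show "finite {w::complex. w ^ e = 1}" using e_pos by (simp add: finite_roots_unity)
    show "(\<lambda>k. \<zeta> ^ k) ` {..<e} \<subseteq> {w. w ^ e = 1}"
      using z by (auto simp flip: power_mult) (metis mult.commute power_mult power_one)
    show "card ((\<lambda>k. \<zeta> ^ k) ` {..<e}) = card {w::complex. w ^ e = 1}"
      using e_pos by (simp add: card_image[OF inj] card_roots_unity_eq)
  qed
  then obtain k where "w = \<zeta> ^ k" using assms by blast
  then show ?thesis using A_power[OF A_closed(2)] by simp
qed

lemma h_closed: "a \<in> A \<Longrightarrow> h a \<in> carrier R"
  using hom by (simp add: ring_hom_closed)

lemma h_add: "\<lbrakk>a \<in> A; b \<in> A\<rbrakk> \<Longrightarrow> h (a + b) = h a \<oplus>\<^bsub>R\<^esub> h b"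
  using ring_hom_add[OF hom, of a b] by (simp add: int_adjoin_def ring_of_type_algebra_def)

lemma h_mult: "\<lbrakk>a \<in> A; b \<in> A\<rbrakk> \<Longrightarrow> h (a * b) = h a \<otimes>\<^bsub>R\<^esub> h b"
  using ring_hom_mult[OF hom, of a b] by (simp add: int_adjoin_def ring_of_type_algebra_def)

lemma h_one: "h 1 = \<one>\<^bsub>R\<^esub>"
  using ring_hom_one[OF hom] by (simp add: int_adjoin_def ring_of_type_algebra_def)

lemma gr_single_closed [simp, intro]:
  "\<lbrakk>r \<in> carrier R; x \<in> carrier G\<rbrakk> \<Longrightarrow> gr_single R r x \<in> carrier S"
  by (auto simp: group_ring_def gr_single_def)

lemma gr_single_add:
  "\<lbrakk>r \<in> carrier R; s \<in> carrier R\<rbrakk> \<Longrightarrow>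
    gr_single R r x \<oplus>\<^bsub>S\<^esub> gr_single R s x = gr_single R (r \<oplus>\<^bsub>R\<^esub> s) x"
  by (auto simp: group_ring_def gr_single_def fun_eq_iff)

text \<open>A convolution with one surviving term. It serves products of group elements and products
  of norm elements of two subgroups meeting trivially, where a factorisation is unique.\<close>

lemma gr_mult_singleton:
  assumes a: "a \<in> carrier S" and b: "b \<in> carrier S" and y: "y \<in> carrier G" and x: "x \<in> carrier G"
    and other: "\<And>z. \<lbrakk>z \<in> carrier G; z \<noteq> y\<rbrakk> \<Longrightarrow> a z \<otimes>\<^bsub>R\<^esub> b (inv z \<otimes> x) = \<zero>\<^bsub>R\<^esub>"
  shows "(a \<otimes>\<^bsub>S\<^esub> b) x = a y \<otimes>\<^bsub>R\<^esub> b (inv y \<otimes> x)"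
proof -
  have cl: "a z \<otimes>\<^bsub>R\<^esub> b (inv z \<otimes> x) \<in> carrier R" if "z \<in> carrier G" for z
    using a b x that by (auto simp: group_ring_def)
  have "(a \<otimes>\<^bsub>S\<^esub> b) x = (\<Oplus>\<^bsub>R\<^esub>z\<in>carrier G. a z \<otimes>\<^bsub>R\<^esub> b (inv z \<otimes> x))"
    using x by (simp add: group_ring_def)
  also have "\<dots> = (\<Oplus>\<^bsub>R\<^esub>z\<in>carrier G. if y = z then a z \<otimes>\<^bsub>R\<^esub> b (inv z \<otimes> x) else \<zero>\<^bsub>R\<^esub>)"
    using cl other by (intro R.finsum_cong') auto
  also have "\<dots> = a y \<otimes>\<^bsub>R\<^esub> b (inv y \<otimes> x)"
    using y fin cl by (intro R.finsum_singleton) auto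
  finally show ?thesis .
qed

lemma gr_mult_zero:
  assumes "a \<in> carrier S" and "b \<in> carrier S" and "x \<in> carrier G"
    and "\<And>z. z \<in> carrier G \<Longrightarrow> a z \<otimes>\<^bsub>R\<^esub> b (inv z \<otimes> x) = \<zero>\<^bsub>R\<^esub>"
  shows "(a \<otimes>\<^bsub>S\<^esub> b) x = \<zero>\<^bsub>R\<^esub>"
  using gr_mult_singleton[OF assms(1,2) assms(3) assms(3)] assms(3,4) assms(4)[OF assms(3)]
  by metis

lemma gr_single_mult:
  assumes "r \<in> carrier R" "s \<in> carrier R" "x \<in> carrier G" "y \<in> carrier G"
  shows "gr_single R r x \<otimes>\<^bsub>S\<^esub> gr_single R s y = gr_single R (r \<otimes>\<^bsub>R\<^esub> s) (x \<otimes> y)"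
proof
  fix z
  have other: "gr_single R r x u \<otimes>\<^bsub>R\<^esub> gr_single R s y (inv u \<otimes> z) = \<zero>\<^bsub>R\<^esub>"
    if "u \<noteq> x" "u \<in> carrier G" "z \<in> carrier G" for u
    using that assms by (auto simp: gr_single_def)
  show "(gr_single R r x \<otimes>\<^bsub>S\<^esub> gr_single R s y) z = gr_single R (r \<otimes>\<^bsub>R\<^esub> s) (x \<otimes> y) z"
  proof (cases "z \<in> carrier G")
    case True
    have "inv x \<otimes> z = y \<longleftrightarrow> z = x \<otimes> y" using assms True by (metis G.inv_solve_left G.m_closed)
    moreover have "(gr_single R r x \<otimes>\<^bsub>S\<^esub> gr_single R s y) z
        = gr_single R r x x \<otimes>\<^bsub>R\<^esub> gr_single R s y (inv x \<otimes> z)"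
      using assms True other by (intro gr_mult_singleton) auto
    ultimately show ?thesis using assms by (simp add: gr_single_def)
  next
    case False
    then show ?thesis using assms by (auto simp: group_ring_def gr_single_def)
  qed
qed

lemma act_closed [simp, intro]: "x \<in> carrier G \<Longrightarrow> act x \<in> carrier S"
  by (simp add: act_def)

lemma act_one: "act \<one> = \<one>\<^bsub>S\<^esub>"
  by (simp add: act_def gr_single_def group_ring_def)

lemma act_mult: "\<lbrakk>x \<in> carrier G; y \<in> carrier G\<rbrakk> \<Longrightarrow> act (x \<otimes> y) = act x \<otimes>\<^bsub>S\<^esub> act y"
  by (simp add: act_def gr_single_mult)

lemma act_pow: "x \<in> carrier G \<Longrightarrow> act (x [^] (n::nat)) = act x [^]\<^bsub>S\<^esub> n"
  by (induction n) (simp_all add: act_one act_mult)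

sublocale ring_scalars S A sc
proof unfold_locales
  show "1 \<in> A" by (rule A_closed)
  show sub: "a - b \<in> A" if "a \<in> A" "b \<in> A" for a b
    using A_closed(3)[OF that(1) A_closed(5)[OF that(2)]] by simp
  show "a * b \<in> A" if "a \<in> A" "b \<in> A" for a b using A_closed that by simp
  show cl: "sc a \<in> carrier S" if "a \<in> A" for a using that by (simp add: sc_def h_closed)
  show "sc 1 = \<one>\<^bsub>S\<^esub>" by (simp add: sc_def h_one gr_single_def group_ring_def)
  show "sc (a - b) = sc a \<ominus>\<^bsub>S\<^esub> sc b" if ab: "a \<in> A" "b \<in> A" for a b
  proof -
    have "sc (a - b) \<oplus>\<^bsub>S\<^esub> sc b = sc a"
      using ab sub[OF ab] h_add[OF sub[OF ab] ab(2)] by (simp add: sc_def gr_single_add h_closed)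
    then show ?thesis using cl[OF ab(1)] cl[OF ab(2)] cl[OF sub[OF ab]]
      by (metis S.add.inv_solve_right a_minus_def)
  qed
  show "sc (a * b) = sc a \<otimes>\<^bsub>S\<^esub> sc b" if "a \<in> A" "b \<in> A" for a b
    using that by (simp add: sc_def gr_single_mult h_closed h_mult)
qed

end

section \<open>Characters and isotypic parts\<close>

context group_ring_scalars
begin

lemma charsI:
  assumes "\<And>x. x \<in> B \<Longrightarrow> \<chi> x ^ e = 1" "\<And>x y. \<lbrakk>x \<in> B; y \<in> B\<rbrakk> \<Longrightarrow> \<chi> (x \<otimes> y) = \<chi> x * \<chi> y"
    "\<chi> \<in> extensional B"
  shows "\<chi> \<in> chars B"
  using assms by (auto simp: char_group_def hom_def roots_of_unity_def)

lemma chars_root: "\<lbrakk>\<chi> \<in> chars B; x \<in> B\<rbrakk> \<Longrightarrow> \<chi> x ^ e = 1"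
  by (auto simp: char_group_def hom_def roots_of_unity_def)

lemma chars_mult: "\<lbrakk>\<chi> \<in> chars B; x \<in> B; y \<in> B\<rbrakk> \<Longrightarrow> \<chi> (x \<otimes> y) = \<chi> x * \<chi> y"
  by (auto simp: char_group_def hom_def roots_of_unity_def)

lemma chars_extensional: "\<chi> \<in> chars B \<Longrightarrow> \<chi> \<in> extensional B"
  by (auto simp: char_group_def)

lemma chars_nonzero: "\<lbrakk>\<chi> \<in> chars B; x \<in> B\<rbrakk> \<Longrightarrow> \<chi> x \<noteq> 0"
  using chars_root[of \<chi> B x] e_pos by (auto simp: power_0_left)

lemma chars_mem: "\<lbrakk>\<chi> \<in> chars B; x \<in> B\<rbrakk> \<Longrightarrow> \<chi> x \<in> A"
  using chars_root root_of_unity_mem by blast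

lemma chars_inverse_mem: "\<lbrakk>\<chi> \<in> chars B; x \<in> B\<rbrakk> \<Longrightarrow> inverse (\<chi> x) \<in> A"
  using chars_root[of \<chi> B x] by (intro root_of_unity_mem) (simp add: power_inverse)

lemma chars_one:
  assumes "\<chi> \<in> chars B" "\<one> \<in> B"
  shows "\<chi> \<one> = 1"
  using chars_mult[OF assms assms(2)] chars_nonzero[OF assms] by simp

lemma chars_pow:
  assumes "\<chi> \<in> chars B" "subgroup B G" "x \<in> B"
  shows "\<chi> (x [^] (n::nat)) = \<chi> x ^ n"
proof (induction n)
  case 0
  show ?case using chars_one[OF assms(1)] subgroup.one_closed[OF assms(2)] by simp
next
  case (Suc n)
  have "x [^] n \<in> B"
    using assms(2,3) by (induction n) (auto intro: subgroup.one_closed subgroup.m_closed)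
  then show ?case using chars_mult[OF assms(1) _ assms(3), of "x [^] n"] Suc by (simp add: mult.commute)
qed

lemma restrict_chars:
  assumes "\<chi> \<in> chars L" "subgroup B G" "B \<subseteq> L"
  shows "restrict \<chi> B \<in> chars B"
  using assms by (intro charsI) (auto intro!: chars_root chars_mult simp: subgroup.m_closed subsetD)

lemma mem_isotypic_iff:
  "x \<in> iso_part B \<chi> N \<longleftrightarrow>
    x \<in> carrier N \<and> (\<forall>\<sigma>\<in>B. act \<sigma> \<odot>\<^bsub>N\<^esub> x = sc (\<chi> \<sigma>) \<odot>\<^bsub>N\<^esub> x)"
  by (simp add: isotypic_def act_def sc_def)

lemma norm_elt_eq:
  assumes "\<chi> \<in> chars B" "B \<subseteq> carrier G"
  shows "norm_elt B \<chi> = (\<lambda>x. if x \<in> B then h (inverse (\<chi> x)) else \<zero>\<^bsub>R\<^esub>)"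
  unfolding char_sum_def
  using assms finite_subset[OF assms(2) fin] R.abelian_monoid_axioms
  by (subst finsum_gr_single) (auto intro!: h_closed chars_inverse_mem)

lemma norm_elt_closed:
  assumes "\<chi> \<in> chars B" "B \<subseteq> carrier G"
  shows "norm_elt B \<chi> \<in> carrier S"
  unfolding norm_elt_eq[OF assms] using assms
  by (auto simp: group_ring_def intro!: h_closed chars_inverse_mem)

lemma norm_elt_eq_finsum:
  assumes "\<chi> \<in> chars B" "B \<subseteq> carrier G"
  shows "norm_elt B \<chi> = (\<Oplus>\<^bsub>S\<^esub>\<sigma>\<in>B. sc (inverse (\<chi> \<sigma>)) \<otimes>\<^bsub>S\<^esub> act \<sigma>)"
proof -
  have "(\<Oplus>\<^bsub>S\<^esub>\<sigma>\<in>B. sc (inverse (\<chi> \<sigma>)) \<otimes>\<^bsub>S\<^esub> act \<sigma>) = (\<Oplus>\<^bsub>S\<^esub>\<sigma>\<in>B. gr_single R (h (inverse (\<chi> \<sigma>))) \<sigma>)"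
    using assms by (intro S.finsum_cong')
      (auto simp: sc_def act_def gr_single_mult h_closed chars_inverse_mem subsetD)
  then show ?thesis
    using assms finite_subset[OF assms(2) fin] R.abelian_monoid_axioms
    by (subst (asm) finsum_gr_single) (auto simp: norm_elt_eq intro!: h_closed chars_inverse_mem)
qed

lemma char_sum_image_eq:
  "char_sum_image R h (G\<lparr>carrier := B\<rparr>) \<chi> N = smult_im N (norm_elt B \<chi>)"
  by (simp add: char_sum_image_def smult_im_def)

text \<open>Because the group ring is commutative, the isotypic part of a subgroup is stable under
  all of it; isotypic parts for another subgroup can then be taken inside.\<close>

lemma isotypic_submodule:
  assumes N: "module S N" and \<chi>: "\<chi> \<in> chars B" and B: "B \<subseteq> carrier G"
  shows "submodule (iso_part B \<chi> N) S N"
proof -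
  interpret N: module S N by (rule N)
  have cl: "act \<sigma> \<in> carrier S" "sc (\<chi> \<sigma>) \<in> carrier S" if "\<sigma> \<in> B" for \<sigma>
    using that B chars_mem[OF \<chi>] by auto
  show ?thesis
  proof (rule N.submoduleI)
    fix a x assume a: "a \<in> carrier S" and x: "x \<in> iso_part B \<chi> N"
    have comm: "b \<odot>\<^bsub>N\<^esub> (a \<odot>\<^bsub>N\<^esub> x) = a \<odot>\<^bsub>N\<^esub> (b \<odot>\<^bsub>N\<^esub> x)" if "b \<in> carrier S" for b
      using a x that by (simp add: mem_isotypic_iff N.smult_assoc1[symmetric] S.m_comm)
    show "a \<odot>\<^bsub>N\<^esub> x \<in> iso_part B \<chi> N" using a x cl comm by (simp add: mem_isotypic_iff)
  qed (use cl in \<open>auto simp: mem_isotypic_iff N.smult_r_distr N.smult_r_minus\<close>)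
qed

lemma isotypic_module:
  assumes "module S N" "\<chi> \<in> chars B" "B \<subseteq> carrier G"
  shows "module S (N\<lparr>carrier := iso_part B \<chi> N\<rparr>)"
  using submodule.submodule_is_module[OF isotypic_submodule[OF assms] assms(1)] .

text \<open>Triviality is read off cosets: the coset of x equals the image itself, and since the
  image contains 0, the coset contains 0 + x = x.\<close>

lemma trivial_tate_H0_imp:
  assumes N: "module S N" and \<chi>: "\<chi> \<in> chars B" and B: "B \<subseteq> carrier G"
    and triv: "trivial_group (tate_H0 R h (G\<lparr>carrier := B\<rparr>) \<chi> N)"
  shows "iso_part B \<chi> N \<subseteq> smult_im N (norm_elt B \<chi>)"
proof
  interpret N: module S N by (rule N)
  let ?I = "smult_im N (norm_elt B \<chi>)"
  fix x assume x: "x \<in> iso_part B \<chi> N"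
  then have "(\<Union>y\<in>?I. {y \<oplus>\<^bsub>N\<^esub> x}) \<in> carrier (tate_H0 R h (G\<lparr>carrier := B\<rparr>) \<chi> N)"
    by (auto simp: tate_H0_def A_FactGroup_def FactGroup_def RCOSETS_def r_coset_def char_sum_image_eq)
  moreover have "\<one>\<^bsub>tate_H0 R h (G\<lparr>carrier := B\<rparr>) \<chi> N\<^esub> = ?I"
    by (simp add: tate_H0_def A_FactGroup_def FactGroup_def char_sum_image_eq)
  ultimately have "(\<Union>y\<in>?I. {y \<oplus>\<^bsub>N\<^esub> x}) = ?I"
    using triv by (simp add: trivial_group_def)
  moreover have "\<zero>\<^bsub>N\<^esub> \<in> ?I"
    using norm_elt_closed[OF \<chi> B] by (auto simp: smult_im_def image_iff intro!: bexI[of _ "\<zero>\<^bsub>N\<^esub>"])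
  moreover have "\<zero>\<^bsub>N\<^esub> \<oplus>\<^bsub>N\<^esub> x = x" using x by (simp add: mem_isotypic_iff)
  ultimately show "x \<in> ?I" by force
qed

section \<open>Cyclic subgroups: characters as roots of unity, isotypic parts as eigenspaces\<close>

lemma cyclic_root_of_unity:
  assumes g: "cyclic_enum G B g m" and w: "w ^ m = 1"
  shows "(w::complex) ^ e = 1"
proof -
  have "m dvd e" using cyclic_enum_dvd[OF g] pow_e g by (simp add: cyclic_enum_def)
  then show ?thesis using w by (metis dvdE power_mult power_one)
qed

lemma isotypic_cyclic:
  assumes N: "module S N" and B: "subgroup B G" and g: "cyclic_enum G B g m" and \<chi>: "\<chi> \<in> chars B"
  shows "iso_part B \<chi> N = smult_ker N (act g \<ominus>\<^bsub>S\<^esub> sc (\<chi> g))"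
proof -
  interpret N: module S N by (rule N)
  have gB: "g \<in> B" "g \<in> carrier G"
    using cyclic_enum_pow_mem[OF g, of 1] g by (auto simp: cyclic_enum_def)
  have cl: "act g \<in> carrier S" "sc (\<chi> g) \<in> carrier S" using gB chars_mem[OF \<chi>] by auto
  have "act \<sigma> \<odot>\<^bsub>N\<^esub> x = sc (\<chi> \<sigma>) \<odot>\<^bsub>N\<^esub> x"
    if x: "x \<in> carrier N" and eq: "act g \<odot>\<^bsub>N\<^esub> x = sc (\<chi> g) \<odot>\<^bsub>N\<^esub> x" and \<sigma>: "\<sigma> \<in> B" for x \<sigma>
  proof -
    have pow: "act g [^]\<^bsub>S\<^esub> k \<odot>\<^bsub>N\<^esub> x = sc (\<chi> g) [^]\<^bsub>S\<^esub> k \<odot>\<^bsub>N\<^esub> x" for k :: nat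
    proof (induction k)
      case (Suc k)
      have "act g [^]\<^bsub>S\<^esub> Suc k \<odot>\<^bsub>N\<^esub> x = act g [^]\<^bsub>S\<^esub> k \<odot>\<^bsub>N\<^esub> (sc (\<chi> g) \<odot>\<^bsub>N\<^esub> x)"
        using x cl by (simp add: N.smult_assoc1 eq)
      also have "\<dots> = sc (\<chi> g) \<odot>\<^bsub>N\<^esub> (act g [^]\<^bsub>S\<^esub> k \<odot>\<^bsub>N\<^esub> x)"
        using x cl by (simp add: N.smult_assoc1[symmetric] S.m_comm)
      also have "\<dots> = sc (\<chi> g) [^]\<^bsub>S\<^esub> Suc k \<odot>\<^bsub>N\<^esub> x"
        using x cl unfolding Suc by (simp add: N.smult_assoc1[symmetric] S.m_comm)
      finally show ?case .
    qed simp
    obtain k :: nat where "\<sigma> = g [^] k" using \<sigma> g by (auto simp: cyclic_enum_def)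
    then show ?thesis
      using pow[of k] gB chars_mem[OF \<chi> gB(1)] by (simp add: act_pow chars_pow[OF \<chi> B] c_power)
  qed
  then show ?thesis
    using gB cl by (auto simp: mem_isotypic_iff smult_ker_def N.minus_smult_distr N.minus_eq_zero_iff)
qed

text \<open>The summand at g^k is the k-th power of the twisted generator, since both the character
  and the embedding of the group are multiplicative.\<close>

lemma norm_elt_cyclic:
  assumes B: "subgroup B G" and g: "cyclic_enum G B g m" and \<chi>: "\<chi> \<in> chars B"
  shows "norm_elt B \<chi> = geom_sum S (sc (inverse (\<chi> g)) \<otimes>\<^bsub>S\<^esub> act g) m"
proof -
  have gB: "g \<in> B" "g \<in> carrier G"
    using cyclic_enum_pow_mem[OF g, of 1] g by (auto simp: cyclic_enum_def)
  have sub: "B \<subseteq> carrier G" by (rule subgroup.subset[OF B])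
  have inj: "inj_on (\<lambda>k. g [^] k) {..<m}" and Beq: "B = (\<lambda>k. g [^] k) ` {..<m}"
    using g by (auto simp: cyclic_enum_def)
  have cl: "sc (inverse (\<chi> \<sigma>)) \<otimes>\<^bsub>S\<^esub> act \<sigma> \<in> carrier S" if "\<sigma> \<in> B" for \<sigma>
    using that sub chars_inverse_mem[OF \<chi>] by auto
  have "norm_elt B \<chi> = (\<Oplus>\<^bsub>S\<^esub>\<sigma>\<in>(\<lambda>k. g [^] k) ` {..<m}. sc (inverse (\<chi> \<sigma>)) \<otimes>\<^bsub>S\<^esub> act \<sigma>)"
    using norm_elt_eq_finsum[OF \<chi> sub] Beq by simp
  also have "\<dots> = (\<Oplus>\<^bsub>S\<^esub>k\<in>{..<m}. sc (inverse (\<chi> (g [^] k))) \<otimes>\<^bsub>S\<^esub> act (g [^] k))"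
    using cl Beq inj by (intro S.finsum_reindex) auto
  also have "\<dots> = geom_sum S (sc (inverse (\<chi> g)) \<otimes>\<^bsub>S\<^esub> act g) m"
    unfolding geom_sum_def using gB chars_inverse_mem[OF \<chi> gB(1)]
    by (intro S.finsum_cong')
      (auto simp: act_pow chars_pow[OF \<chi> B] S.nat_pow_distrib c_power power_inverse[symmetric])
  finally show ?thesis .
qed

lemma bij_betw_chars_cyclic:
  assumes B: "subgroup B G" and g: "cyclic_enum G B g m"
  shows "bij_betw (\<lambda>\<chi>. \<chi> g) (chars B) {w. w ^ m = 1}"
proof (rule bij_betw_imageI)
  have gB: "g \<in> B" "g \<in> carrier G" "g [^] m = \<one>"
    using cyclic_enum_pow_mem[OF g, of 1] g by (auto simp: cyclic_enum_def)
  have one: "\<one> \<in> B" by (rule subgroup.one_closed[OF B])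
  have Beq: "B = (\<lambda>k. g [^] k) ` {..<m}" using g by (auto simp: cyclic_enum_def)
  show "inj_on (\<lambda>\<chi>. \<chi> g) (chars B)"
  proof (rule inj_onI)
    fix \<chi> \<psi> assume \<chi>: "\<chi> \<in> chars B" and \<psi>: "\<psi> \<in> chars B" and eq: "\<chi> g = \<psi> g"
    show "\<chi> = \<psi>"
    proof (rule extensionalityI[OF chars_extensional[OF \<chi>] chars_extensional[OF \<psi>]])
      fix x assume "x \<in> B"
      then obtain k :: nat where "x = g [^] k" using Beq by blast
      then show "\<chi> x = \<psi> x" using eq chars_pow[OF \<chi> B gB(1)] chars_pow[OF \<psi> B gB(1)] by simp
    qed
  qed
  show "(\<lambda>\<chi>. \<chi> g) ` chars B = {w. w ^ m = 1}"
  proof (intro equalityI subsetI)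
    fix w assume "w \<in> (\<lambda>\<chi>. \<chi> g) ` chars B"
    then obtain \<chi> where \<chi>: "\<chi> \<in> chars B" "w = \<chi> g" by blast
    then show "w \<in> {w. w ^ m = 1}"
      using chars_pow[OF \<chi>(1) B gB(1), of m] chars_one[OF \<chi>(1) one] gB(3) by simp
  next
    fix w :: complex assume "w \<in> {w. w ^ m = 1}"
    then have w: "w ^ m = 1" by simp
    \<comment> \<open>An arbitrary exponent of x. It is determined modulo m, which suffices because
      w^m = 1.\<close>
    define ix where "ix x = (SOME k. g [^] (k::nat) = x)" for x
    define \<chi> where "\<chi> = restrict (\<lambda>x. w ^ ix x) B"
    have ix: "g [^] ix x = x" if "x \<in> B" for x
      unfolding ix_def using that Beq by (intro someI_ex[of "\<lambda>k. g [^] k = x"]) blast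
    have wmod: "w ^ i = w ^ j" if "g [^] i = g [^] j" for i j :: nat
    proof -
      have red: "w ^ k = w ^ (k mod m)" for k
      proof -
        have "w ^ k = w ^ (m * (k div m) + k mod m)" by simp
        also have "\<dots> = (w ^ m) ^ (k div m) * w ^ (k mod m)" by (simp only: power_add power_mult)
        finally show ?thesis using w by simp
      qed
      show ?thesis using that cyclic_enum_pow_eq_iff[OF g] red[of i] red[of j] by simp
    qed
    have val: "\<chi> (g [^] k) = w ^ k" for k :: nat
    proof -
      have "g [^] k \<in> B" by (rule cyclic_enum_pow_mem[OF g])
      then show ?thesis using wmod[OF ix] by (simp add: \<chi>_def)
    qed
    have "\<chi> \<in> chars B"
    proof (rule charsI)
      fix x y assume "x \<in> B" "y \<in> B"
      then obtain i j :: nat where "x = g [^] i" "y = g [^] j" using Beq by blast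
      then show "\<chi> (x \<otimes> y) = \<chi> x * \<chi> y" using gB by (simp add: nat_pow_mult val power_add)
    next
      fix x assume "x \<in> B"
      then obtain i :: nat where "x = g [^] i" using Beq by blast
      then show "\<chi> x ^ e = 1"
        using val[of i] cyclic_root_of_unity[OF g w] by (metis mult.commute power_mult power_one)
    qed (simp add: \<chi>_def)
    moreover have "\<chi> g = w" using val[of 1] gB by simp
    ultimately show "w \<in> (\<lambda>\<chi>. \<chi> g) ` chars B" by force
  qed
qed

lemma cyclic_decomposition:
  assumes N: "module S N" and finN: "finite (carrier N)"
    and K: "subgroup K G" and g: "cyclic_enum G K g (p ^ k * p)"
    and H: "subgroup H G" "H \<subseteq> K" "card H = p"
    and vanish: "\<And>\<chi>. \<chi> \<in> chars H \<Longrightarrow> iso_part H \<chi> N \<subseteq> smult_im N (norm_elt H \<chi>)"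
  shows "card (carrier N) = (\<Prod>\<chi>\<in>chars K. card (iso_part K \<chi> N))"
    and "\<And>\<chi>. \<chi> \<in> chars K \<Longrightarrow> iso_part K \<chi> N = smult_im N (norm_elt K \<chi>)"
proof -
  interpret module_scalars S N A sc
    by (intro module_scalars.intro N ring_scalars_axioms)
  let ?m = "p ^ k * p" and ?q = "p ^ k"
  have gG: "g \<in> carrier G" "g [^] ?m = \<one>" and p: "p > 0" using g by (auto simp: cyclic_enum_def)
  have W: "{w. w ^ ?m = 1} \<subseteq> A" using cyclic_root_of_unity[OF g] root_of_unity_mem by blast
  have act: "act g \<in> carrier S" "act g [^]\<^bsub>S\<^esub> ?m = \<one>\<^bsub>S\<^esub>"
    using gG act_pow[of g ?m] by (simp_all add: act_one)
  have gH: "cyclic_enum G H (g [^] ?q) p" by (rule cyclic_enum_subgroup[OF g H])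
  have "smult_ker N (act g [^]\<^bsub>S\<^esub> ?q \<ominus>\<^bsub>S\<^esub> sc w)
      \<subseteq> smult_im N (geom_sum S (sc (inverse w) \<otimes>\<^bsub>S\<^esub> act g [^]\<^bsub>S\<^esub> ?q) p)"
    if w: "w ^ p = 1" for w
  proof -
    \<comment> \<open>Every p-th root of unity is the value of some character of H at its generator;
      this is where all characters of H are used.\<close>
    obtain \<chi> where \<chi>: "\<chi> \<in> chars H" "\<chi> (g [^] ?q) = w"
      using bij_betw_imp_surj_on[OF bij_betw_chars_cyclic[OF H(1) gH]] w by force
    show ?thesis
      using vanish[OF \<chi>(1)] \<chi>(2) gG isotypic_cyclic[OF N H(1) gH \<chi>(1)] norm_elt_cyclic[OF H(1) gH \<chi>(1)]
      by (simp add: act_pow)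
  qed
  note * = card_eq_prod_eigenspaces[OF finN p refl W act this]
  note bij = bij_betw_chars_cyclic[OF K g]
  have "card (carrier N) = (\<Prod>w\<in>{w. w ^ ?m = 1}. card (smult_ker N (act g \<ominus>\<^bsub>S\<^esub> sc w)))"
    by (rule *(1))
  also have "\<dots> = (\<Prod>\<chi>\<in>chars K. card (smult_ker N (act g \<ominus>\<^bsub>S\<^esub> sc (\<chi> g))))"
    by (rule prod.reindex_bij_betw[OF bij, symmetric])
  also have "\<dots> = (\<Prod>\<chi>\<in>chars K. card (iso_part K \<chi> N))"
    by (intro prod.cong refl) (simp add: isotypic_cyclic[OF N K g])
  finally show "card (carrier N) = (\<Prod>\<chi>\<in>chars K. card (iso_part K \<chi> N))" .
  fix \<chi> assume \<chi>: "\<chi> \<in> chars K"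
  then have "\<chi> g ^ ?m = 1" using bij_betwE[OF bij] by blast
  then show "iso_part K \<chi> N = smult_im N (norm_elt K \<chi>)"
    using *(2) isotypic_cyclic[OF N K g \<chi>] norm_elt_cyclic[OF K g \<chi>] by simp
qed

end

section \<open>Direct products\<close>

lemma (in group) subgroup_product_unique:
  assumes B: "subgroup B G" and K: "subgroup K G" and BK: "B \<inter> K = {\<one>}"
    and "b \<in> B" "b' \<in> B" "k \<in> K" "k' \<in> K" and eq: "b \<otimes> k = b' \<otimes> k'"
  shows "b = b' \<and> k = k'"
proof -
  have cl: "b \<in> carrier G" "b' \<in> carrier G" "k \<in> carrier G" "k' \<in> carrier G"
    using assms subgroup.subset by blast+
  have "inv b' \<otimes> b = k' \<otimes> inv k" using cl eq by (metis inv_closed inv_solve_left inv_solve_right m_assoc m_closed)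
  moreover have "inv b' \<otimes> b \<in> B" "k' \<otimes> inv k \<in> K"
    using assms by (auto intro: subgroup.m_closed subgroup.m_inv_closed)
  ultimately have "inv b' \<otimes> b = \<one>" "k' \<otimes> inv k = \<one>" using BK by auto
  then show ?thesis using cl by (metis inv_equality inv_inv inv_closed)
qed

lemma (in group) subgroup_subset_set_mult:
  assumes "subgroup B G" "subgroup K G"
  shows "B \<subseteq> B <#> K" "K \<subseteq> B <#> K"
proof -
  have sub: "B \<subseteq> carrier G" "K \<subseteq> carrier G" and one: "\<one> \<in> B" "\<one> \<in> K"
    using assms by (auto dest: subgroup.subset intro: subgroup.one_closed)
  show "B \<subseteq> B <#> K"
  proof
    fix b assume "b \<in> B"
    then have "b \<otimes> \<one> = b" "b \<otimes> \<one> \<in> B <#> K" using sub one by (auto simp: set_mult_def)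
    then show "b \<in> B <#> K" by simp
  qed
  show "K \<subseteq> B <#> K"
  proof
    fix k assume "k \<in> K"
    then have "\<one> \<otimes> k = k" "\<one> \<otimes> k \<in> B <#> K" using sub one by (auto simp: set_mult_def)
    then show "k \<in> B <#> K" by simp
  qed
qed

context group_ring_scalars
begin

lemma bij_betw_chars_product:
  assumes B: "subgroup B G" and K: "subgroup K G" and BK: "B \<inter> K = {\<one>}"
  shows "bij_betw (\<lambda>\<psi>. (restrict \<psi> B, restrict \<psi> K)) (chars (B <#> K)) (chars B \<times> chars K)"
proof (rule bij_betw_imageI)
  let ?L = "B <#> K"
  have sub: "B \<subseteq> carrier G" "K \<subseteq> carrier G" using B K by (auto dest: subgroup.subset)
  have one: "\<one> \<in> B" "\<one> \<in> K" using B K by (auto intro: subgroup.one_closed)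
  have L: "x \<in> ?L \<longleftrightarrow> (\<exists>b\<in>B. \<exists>k\<in>K. x = b \<otimes> k)" for x by (auto simp: set_mult_def)
  note BL = subgroup_subset_set_mult(1)[OF B K] and KL = subgroup_subset_set_mult(2)[OF B K]
  show "inj_on (\<lambda>\<psi>. (restrict \<psi> B, restrict \<psi> K)) (chars ?L)"
  proof (rule inj_onI)
    fix \<psi> \<phi> assume \<psi>: "\<psi> \<in> chars ?L" and \<phi>: "\<phi> \<in> chars ?L"
      and eq: "(restrict \<psi> B, restrict \<psi> K) = (restrict \<phi> B, restrict \<phi> K)"
    show "\<psi> = \<phi>"
    proof (rule extensionalityI[OF chars_extensional[OF \<psi>] chars_extensional[OF \<phi>]])
      fix x assume "x \<in> ?L"
      then obtain b k where x: "b \<in> B" "k \<in> K" "x = b \<otimes> k" using L by blast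
      have "\<psi> b = \<phi> b" "\<psi> k = \<phi> k" using x eq by (metis prod.inject restrict_apply')+
      moreover have "b \<in> ?L" "k \<in> ?L" using x BL KL by blast+
      ultimately show "\<psi> x = \<phi> x" using x(3) by (simp add: chars_mult[OF \<psi>] chars_mult[OF \<phi>])
    qed
  qed
  show "(\<lambda>\<psi>. (restrict \<psi> B, restrict \<psi> K)) ` chars ?L = chars B \<times> chars K"
  proof (intro equalityI subsetI)
    fix y assume "y \<in> (\<lambda>\<psi>. (restrict \<psi> B, restrict \<psi> K)) ` chars ?L"
    then show "y \<in> chars B \<times> chars K"
      using restrict_chars[OF _ B BL] restrict_chars[OF _ K KL] by blast
  next
    fix y assume "y \<in> chars B \<times> chars K"
    then obtain \<alpha> \<beta> where \<alpha>: "\<alpha> \<in> chars B" and \<beta>: "\<beta> \<in> chars K" and y: "y = (\<alpha>, \<beta>)" by blast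
    \<comment> \<open>A chosen factorisation; trivial intersection makes it the only one, so
      \<open>val\<close> may compute with any given b and k.\<close>
    define pr where "pr x = (SOME u. fst u \<in> B \<and> snd u \<in> K \<and> x = fst u \<otimes> snd u)" for x
    define \<psi> where "\<psi> = restrict (\<lambda>x. \<alpha> (fst (pr x)) * \<beta> (snd (pr x))) ?L"
    have val: "\<psi> (b \<otimes> k) = \<alpha> b * \<beta> k" if bk: "b \<in> B" "k \<in> K" for b k
    proof -
      have "\<exists>u. fst u \<in> B \<and> snd u \<in> K \<and> b \<otimes> k = fst u \<otimes> snd u"
        using bk by (intro exI[of _ "(b, k)"]) simp
      from someI_ex[OF this] have u: "fst (pr (b \<otimes> k)) \<in> B" "snd (pr (b \<otimes> k)) \<in> K"
        "b \<otimes> k = fst (pr (b \<otimes> k)) \<otimes> snd (pr (b \<otimes> k))"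
        by (auto simp: pr_def)
      have "fst (pr (b \<otimes> k)) = b \<and> snd (pr (b \<otimes> k)) = k"
        by (rule subgroup_product_unique[OF B K BK u(1) bk(1) u(2) bk(2) u(3)[symmetric]])
      moreover have "b \<otimes> k \<in> ?L" using bk L by blast
      ultimately show ?thesis by (simp add: \<psi>_def)
    qed
    have "\<psi> \<in> chars ?L"
    proof (rule charsI)
      fix x assume "x \<in> ?L"
      then obtain b k where x: "b \<in> B" "k \<in> K" "x = b \<otimes> k" using L by blast
      then show "\<psi> x ^ e = 1"
        using val[OF x(1,2)] by (simp add: power_mult_distrib chars_root[OF \<alpha>] chars_root[OF \<beta>])
    next
      fix x x' assume "x \<in> ?L" "x' \<in> ?L"
      then obtain b k b' k' where x: "b \<in> B" "k \<in> K" "x = b \<otimes> k" and x': "b' \<in> B" "k' \<in> K" "x' = b' \<otimes> k'"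
        using L by meson
      then have cl: "b \<in> carrier G" "b' \<in> carrier G" "k \<in> carrier G" "k' \<in> carrier G"
        using sub by blast+
      have "x \<otimes> x' = (b \<otimes> b') \<otimes> (k \<otimes> k')" using cl x x' by (simp add: m_ac)
      moreover have "b \<otimes> b' \<in> B" "k \<otimes> k' \<in> K"
        using x x' B K by (auto intro: subgroup.m_closed)
      ultimately have "\<psi> (x \<otimes> x') = \<alpha> (b \<otimes> b') * \<beta> (k \<otimes> k')" by (simp add: val)
      also have "\<dots> = \<psi> x * \<psi> x'"
        using x x' by (simp add: val chars_mult[OF \<alpha>] chars_mult[OF \<beta>])
      finally show "\<psi> (x \<otimes> x') = \<psi> x * \<psi> x'" .
    qed (simp add: \<psi>_def)
    moreover have "restrict \<psi> B = \<alpha>"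
    proof (rule extensionalityI[OF restrict_extensional chars_extensional[OF \<alpha>]])
      fix b assume "b \<in> B"
      then show "restrict \<psi> B b = \<alpha> b"
        using val[OF _ one(2), of b] sub chars_one[OF \<beta> one(2)] by (simp add: subsetD)
    qed
    moreover have "restrict \<psi> K = \<beta>"
    proof (rule extensionalityI[OF restrict_extensional chars_extensional[OF \<beta>]])
      fix k assume "k \<in> K"
      then show "restrict \<psi> K k = \<beta> k"
        using val[OF one(1), of k] sub chars_one[OF \<alpha> one(1)] by (simp add: subsetD)
    qed
    ultimately show "y \<in> (\<lambda>\<psi>. (restrict \<psi> B, restrict \<psi> K)) ` chars ?L" using y by force
  qed
qed

lemma isotypic_product:
  assumes N: "module S N" and B: "subgroup B G" and K: "subgroup K G"
    and \<psi>: "\<psi> \<in> chars (B <#> K)"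
  shows "iso_part (B <#> K) \<psi> N
    = iso_part K (restrict \<psi> K) (N\<lparr>carrier := iso_part B (restrict \<psi> B) N\<rparr>)"
proof -
  interpret N: module S N by (rule N)
  note sub = subgroup_subset_set_mult[OF B K]
  have "act (b \<otimes> k) \<odot>\<^bsub>N\<^esub> x = sc (\<psi> (b \<otimes> k)) \<odot>\<^bsub>N\<^esub> x"
    if b: "b \<in> B" "k \<in> K" and x: "x \<in> carrier N"
      and eq: "act b \<odot>\<^bsub>N\<^esub> x = sc (\<psi> b) \<odot>\<^bsub>N\<^esub> x" "act k \<odot>\<^bsub>N\<^esub> x = sc (\<psi> k) \<odot>\<^bsub>N\<^esub> x" for b k x
  proof -
    have mem: "b \<in> B <#> K" "k \<in> B <#> K" using b sub by blast+
    have G: "b \<in> carrier G" "k \<in> carrier G" using b B K subgroup.subset by blast+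
    have cl: "act b \<in> carrier S" "act k \<in> carrier S" "sc (\<psi> b) \<in> carrier S" "sc (\<psi> k) \<in> carrier S"
      using G chars_mem[OF \<psi>] mem by auto
    have "act (b \<otimes> k) \<odot>\<^bsub>N\<^esub> x = act b \<odot>\<^bsub>N\<^esub> (sc (\<psi> k) \<odot>\<^bsub>N\<^esub> x)"
      using G cl x by (simp add: act_mult N.smult_assoc1 eq)
    also have "\<dots> = sc (\<psi> k) \<odot>\<^bsub>N\<^esub> (act b \<odot>\<^bsub>N\<^esub> x)"
      using cl x by (simp add: N.smult_assoc1[symmetric] S.m_comm)
    also have "\<dots> = sc (\<psi> (b \<otimes> k)) \<odot>\<^bsub>N\<^esub> x"
      using cl x mem by (simp add: eq N.smult_assoc1[symmetric] S.m_comm chars_mult[OF \<psi>] c_mult chars_mem[OF \<psi>])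
    finally show ?thesis .
  qed
  then have "(\<forall>\<sigma>\<in>B <#> K. act \<sigma> \<odot>\<^bsub>N\<^esub> x = sc (\<psi> \<sigma>) \<odot>\<^bsub>N\<^esub> x) \<longleftrightarrow>
      (\<forall>\<sigma>\<in>B. act \<sigma> \<odot>\<^bsub>N\<^esub> x = sc (\<psi> \<sigma>) \<odot>\<^bsub>N\<^esub> x) \<and> (\<forall>\<sigma>\<in>K. act \<sigma> \<odot>\<^bsub>N\<^esub> x = sc (\<psi> \<sigma>) \<odot>\<^bsub>N\<^esub> x)"
    if "x \<in> carrier N" for x
    using sub that by (auto simp: set_mult_def)
  then show ?thesis by (auto simp: mem_isotypic_iff)
qed

text \<open>Compared coefficient by coefficient: an element of the product has exactly one
  factorisation, and inverse character values multiply along it.\<close>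

lemma norm_elt_product:
  assumes B: "subgroup B G" and K: "subgroup K G" and BK: "B \<inter> K = {\<one>}"
    and \<psi>: "\<psi> \<in> chars (B <#> K)"
  shows "norm_elt (B <#> K) \<psi> = norm_elt B (restrict \<psi> B) \<otimes>\<^bsub>S\<^esub> norm_elt K (restrict \<psi> K)"
proof
  fix x
  note sub = subgroup_subset_set_mult[OF B K]
  let ?a = "norm_elt B (restrict \<psi> B)" and ?b = "norm_elt K (restrict \<psi> K)"
  have G: "B \<subseteq> carrier G" "K \<subseteq> carrier G" using B K by (auto dest: subgroup.subset)
  have LG: "B <#> K \<subseteq> carrier G" using G by (auto simp: set_mult_def)
  note res = restrict_chars[OF \<psi> B sub(1)] restrict_chars[OF \<psi> K sub(2)]
  have cl: "?a \<in> carrier S" "?b \<in> carrier S" using norm_elt_closed res G by blast+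
  have a: "?a y = (if y \<in> B then h (inverse (\<psi> y)) else \<zero>\<^bsub>R\<^esub>)"
    and b: "?b y = (if y \<in> K then h (inverse (\<psi> y)) else \<zero>\<^bsub>R\<^esub>)" for y
    using norm_elt_eq[OF res(1) G(1)] norm_elt_eq[OF res(2) G(2)] by simp_all
  have hcl: "h (inverse (\<psi> y)) \<in> carrier R" if "y \<in> B <#> K" for y
    using chars_inverse_mem[OF \<psi> that] h_closed by blast
  have aR: "?a y \<in> carrier R" and bR: "?b y \<in> carrier R" for y
    using hcl sub by (auto simp: a b)
  have zero: "?a z \<otimes>\<^bsub>R\<^esub> ?b y = \<zero>\<^bsub>R\<^esub>" if "z \<notin> B \<or> y \<notin> K" for z y
  proof -
    have "?a z = \<zero>\<^bsub>R\<^esub> \<or> ?b y = \<zero>\<^bsub>R\<^esub>" using that by (simp add: a b)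
    then show ?thesis using R.l_null[OF bR[of y]] R.r_null[OF aR[of z]] by metis
  qed
  have dec: "x = y \<otimes> (inv y \<otimes> x)" if "y \<in> B" "x \<in> carrier G" for y
    using that G by (simp add: m_assoc[symmetric] subsetD)
  \<comment> \<open>Outside the carrier both sides are 0 by the convention on coefficient functions,
    so it is a case of its own.\<close>
  consider (L) "x \<in> B <#> K" | (G) "x \<in> carrier G" "x \<notin> B <#> K" | (out) "x \<notin> carrier G" by blast
  then show "norm_elt (B <#> K) \<psi> x = (?a \<otimes>\<^bsub>S\<^esub> ?b) x"
  proof cases
    case L
    then obtain y k where x: "y \<in> B" "k \<in> K" "x = y \<otimes> k" by (auto simp: set_mult_def)
    have yG: "y \<in> carrier G" "k \<in> carrier G" "x \<in> carrier G" using x G LG L by blast+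
    have "(?a \<otimes>\<^bsub>S\<^esub> ?b) x = ?a y \<otimes>\<^bsub>R\<^esub> ?b (inv y \<otimes> x)"
    proof (rule gr_mult_singleton[OF cl yG(1,3)])
      fix z assume z: "z \<in> carrier G" "z \<noteq> y"
      have "z \<notin> B \<or> inv z \<otimes> x \<notin> K"
      proof (rule ccontr)
        assume "\<not> ?thesis"
        then have zB: "z \<in> B" "inv z \<otimes> x \<in> K" by simp_all
        have "y \<otimes> k = z \<otimes> (inv z \<otimes> x)" using dec[OF zB(1) yG(3)] x(3) by simp
        then have "y = z" using subgroup_product_unique[OF B K BK x(1) zB(1) x(2) zB(2)] by simp
        then show False using z(2) by simp
      qed
      then show "?a z \<otimes>\<^bsub>R\<^esub> ?b (inv z \<otimes> x) = \<zero>\<^bsub>R\<^esub>" by (rule zero)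
    qed
    also have "inv y \<otimes> x = k" using yG by (simp add: x(3) m_assoc[symmetric])
    also have "?a y \<otimes>\<^bsub>R\<^esub> ?b k = h (inverse (\<psi> y) * inverse (\<psi> k))"
      using x sub chars_inverse_mem[OF \<psi>] by (subst h_mult) (auto simp: a b)
    also have "inverse (\<psi> y) * inverse (\<psi> k) = inverse (\<psi> x)"
      using x sub chars_mult[OF \<psi>, of y k] by (auto simp: subsetD)
    finally have "(?a \<otimes>\<^bsub>S\<^esub> ?b) x = h (inverse (\<psi> x))" .
    moreover have "norm_elt (B <#> K) \<psi> x = h (inverse (\<psi> x))"
      using L norm_elt_eq[OF \<psi> LG] by simp
    ultimately show ?thesis by (simp only:)
  next
    case G
    have "(?a \<otimes>\<^bsub>S\<^esub> ?b) x = \<zero>\<^bsub>R\<^esub>"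
    proof (rule gr_mult_zero[OF cl G(1)])
      fix z assume z: "z \<in> carrier G"
      have "z \<notin> B \<or> inv z \<otimes> x \<notin> K"
        using G dec[of z] unfolding set_mult_def by blast
      then show "?a z \<otimes>\<^bsub>R\<^esub> ?b (inv z \<otimes> x) = \<zero>\<^bsub>R\<^esub>" by (rule zero)
    qed
    then show ?thesis using G norm_elt_eq[OF \<psi> LG] by simp
  next
    case out
    then show ?thesis using LG norm_elt_eq[OF \<psi> LG] by (auto simp: group_ring_def)
  qed
qed

text \<open>For \<psi> with restrictions \<alpha> and \<beta>, the equality of isotypic part and
  image propagates as M^\<psi> = \<epsilon>_\<beta> M^\<alpha> = \<epsilon>_\<beta>
  \<epsilon>_\<alpha> M = \<epsilon>_\<psi> M. The middle step is why images are tracked along with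
  orders.\<close>

lemma product_decomposition:
  assumes N: "module S N" and B: "subgroup B G" and K: "subgroup K G" and BK: "B \<inter> K = {\<one>}"
    and IH: "card (carrier N) = (\<Prod>\<psi>\<in>chars B. card (iso_part B \<psi> N))"
      "\<And>\<psi>. \<psi> \<in> chars B \<Longrightarrow> iso_part B \<psi> N = smult_im N (norm_elt B \<psi>)"
    and step: "\<And>\<psi>. \<psi> \<in> chars B \<Longrightarrow> card (iso_part B \<psi> N)
        = (\<Prod>\<chi>\<in>chars K. card (iso_part K \<chi> (N\<lparr>carrier := iso_part B \<psi> N\<rparr>)))"
      "\<And>\<psi> \<chi>. \<lbrakk>\<psi> \<in> chars B; \<chi> \<in> chars K\<rbrakk> \<Longrightarrow> iso_part K \<chi> (N\<lparr>carrier := iso_part B \<psi> N\<rparr>)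
        = smult_im (N\<lparr>carrier := iso_part B \<psi> N\<rparr>) (norm_elt K \<chi>)"
  shows "card (carrier N) = (\<Prod>\<psi>\<in>chars (B <#> K). card (iso_part (B <#> K) \<psi> N))"
    and "\<And>\<psi>. \<psi> \<in> chars (B <#> K) \<Longrightarrow>
      iso_part (B <#> K) \<psi> N = smult_im N (norm_elt (B <#> K) \<psi>)"
proof -
  interpret N: module S N by (rule N)
  let ?L = "B <#> K"
  have G: "B \<subseteq> carrier G" "K \<subseteq> carrier G" using B K by (auto dest: subgroup.subset)
  note BL = subgroup_subset_set_mult(1)[OF B K] and KL = subgroup_subset_set_mult(2)[OF B K]
  note iso = isotypic_product[OF N B K]
  have "card (carrier N) = (\<Prod>\<psi>\<in>chars B. \<Prod>\<chi>\<in>chars K. card (iso_part K \<chi> (N\<lparr>carrier := iso_part B \<psi> N\<rparr>)))"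
    unfolding IH(1) by (intro prod.cong refl step)
  also have "\<dots> = (\<Prod>u\<in>chars B \<times> chars K. card (iso_part K (snd u) (N\<lparr>carrier := iso_part B (fst u) N\<rparr>)))"
    by (simp add: prod.cartesian_product case_prod_beta)
  also have "\<dots> = (\<Prod>\<psi>\<in>chars ?L. card (iso_part ?L \<psi> N))"
    by (subst prod.reindex_bij_betw[OF bij_betw_chars_product[OF B K BK], symmetric])
      (simp add: iso)
  finally show "card (carrier N) = (\<Prod>\<psi>\<in>chars ?L. card (iso_part ?L \<psi> N))" .
  fix \<psi> assume \<psi>: "\<psi> \<in> chars ?L"
  let ?\<alpha> = "restrict \<psi> B" and ?\<beta> = "restrict \<psi> K"
  note res = restrict_chars[OF \<psi> B BL] restrict_chars[OF \<psi> K KL]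
  have cl: "norm_elt B ?\<alpha> \<in> carrier S" "norm_elt K ?\<beta> \<in> carrier S"
    using norm_elt_closed res G by blast+
  have "iso_part ?L \<psi> N = (\<lambda>x. norm_elt K ?\<beta> \<odot>\<^bsub>N\<^esub> x) ` iso_part B ?\<alpha> N"
    using iso[OF \<psi>] step(2)[OF res] by (simp add: smult_im_def)
  also have "\<dots> = (\<lambda>x. norm_elt K ?\<beta> \<odot>\<^bsub>N\<^esub> (norm_elt B ?\<alpha> \<odot>\<^bsub>N\<^esub> x)) ` carrier N"
    unfolding IH(2)[OF res(1)] by (simp add: smult_im_def image_image)
  also have "\<dots> = smult_im N (norm_elt ?L \<psi>)"
    using norm_elt_product[OF B K BK \<psi>] cl
    unfolding smult_im_def by (intro image_cong refl) (simp add: N.smult_assoc1[symmetric] S.m_comm)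
  finally show "iso_part ?L \<psi> N = smult_im N (norm_elt ?L \<psi>)" .
qed

lemma trivial_decomposition:
  assumes N: "module S N"
  shows "card (carrier N) = (\<Prod>\<psi>\<in>chars {\<one>}. card (iso_part {\<one>} \<psi> N))"
    and "\<And>\<psi>. \<psi> \<in> chars {\<one>} \<Longrightarrow> iso_part {\<one>} \<psi> N = smult_im N (norm_elt {\<one>} \<psi>)"
proof -
  interpret N: module S N by (rule N)
  \<comment> \<open>Viewing the trivial group as cyclic of order 1 yields its single character and
    its norm element 1 from the cyclic case.\<close>
  have enum: "cyclic_enum G {\<one>} \<one> 1" by (auto simp: cyclic_enum_def inj_on_def)
  note triv = triv_subgroup
  have iso: "iso_part {\<one>} \<psi> N = carrier N" if "\<psi> \<in> chars {\<one>}" for \<psi>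
    using chars_one[OF that] by (auto simp: mem_isotypic_iff act_one c_one)
  have "card (chars {\<one>}) = 1"
    using bij_betw_same_card[OF bij_betw_chars_cyclic[OF triv enum]] by simp
  then show "card (carrier N) = (\<Prod>\<psi>\<in>chars {\<one>}. card (iso_part {\<one>} \<psi> N))" by (simp add: iso)
  fix \<psi> assume \<psi>: "\<psi> \<in> chars {\<one>}"
  have "norm_elt {\<one>} \<psi> = \<one>\<^bsub>S\<^esub>"
    using norm_elt_cyclic[OF triv enum \<psi>] chars_one[OF \<psi>] S.geom_sum_Suc[OF S.one_closed, of 0]
    by (simp add: act_one c_one)
  then show "iso_part {\<one>} \<psi> N = smult_im N (norm_elt {\<one>} \<psi>)"
    by (simp add: iso[OF \<psi>] smult_im_def)
qed

end

section \<open>Induction over the cyclic factors\<close>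

theorem theorem4p12:
  fixes G :: "('g, 'b) monoid_scheme"
    and R :: "('r, 'a) ring_scheme"
    and M :: "('g \<Rightarrow> 'r, 'm, 'c) module_scheme"
    and \<zeta> :: complex
    and h :: "complex \<Rightarrow> 'r"
    and e r :: nat
    and p :: "nat \<Rightarrow> nat"
    and K Gsub H :: "nat \<Rightarrow> 'g set"
  assumes "comm_group G" and "finite (carrier G)"
    and "e = group_exponent G"
    and "primitive_root_of_unity e \<zeta>"
    and "cring R"
    and "h \<in> ring_hom (int_adjoin \<zeta>) R"
    and "module (group_ring R G) M" and "finite (carrier M)"
    and "\<And>i. i \<in> {1..r} \<Longrightarrow> subgroup (K i) G"
    and "(\<lambda>k. \<Otimes>\<^bsub>G\<^esub>i\<in>{1..r}. k i) \<in> iso (product_group {1..r} (\<lambda>i. G\<lparr>carrier := K i\<rparr>)) G"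
    and "\<And>i. i \<in> {1..r} \<Longrightarrow> Factorial_Ring.prime (p i)"
    and "\<And>i. i \<in> {1..r} \<Longrightarrow> cyclic_group (G\<lparr>carrier := K i\<rparr>)"
    and "\<And>i. i \<in> {1..r} \<Longrightarrow> K i \<noteq> {\<one>\<^bsub>G\<^esub>}"
    and "\<And>i. i \<in> {1..r} \<Longrightarrow> \<exists>n. card (K i) = p i ^ n"
    and "\<And>i. i < r \<Longrightarrow> Gsub i = (\<lambda>k. \<Otimes>\<^bsub>G\<^esub>j\<in>{1..i}. k j) ` (\<Pi>\<^sub>E j\<in>{1..i}. K j)"
    and "\<And>i. i \<in> {1..r} \<Longrightarrow> subgroup (H i) G \<and> H i \<subseteq> K i \<and> card (H i) = p i"
    and "\<And>i \<chi> \<psi>. \<lbrakk>i \<in> {1..r}; \<chi> \<in> char_group e (G\<lparr>carrier := H i\<rparr>);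
            \<psi> \<in> char_group e (G\<lparr>carrier := Gsub (i - 1)\<rparr>)\<rbrakk> \<Longrightarrow>
          trivial_group (tate_H0 R h (G\<lparr>carrier := H i\<rparr>) \<chi>
            (M\<lparr>carrier := isotypic R h (G\<lparr>carrier := Gsub (i - 1)\<rparr>) \<psi> M\<rparr>))"
  shows "card (carrier M) = (\<Prod>\<psi>\<in>char_group e G. card (isotypic R h G \<psi> M))
    \<and> (\<Prod>\<psi>\<in>char_group e G. card (isotypic R h G \<psi> M))
        = (\<Prod>\<psi>\<in>char_group e G. card (char_sum_image R h G \<psi> M))"
proof -
  note vanish_hyp = assms(17)
  interpret M: module "group_ring R G" M by fact
  have grs: "group_ring_scalars G R \<zeta> h e"
    using assms(1-6) M.R.cring_axioms
    by (simp add: group_ring_scalars_def group_ring_scalars_axioms_def)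
  interpret group_ring_scalars G R \<zeta> h e by (rule grs)
  have M: "module S M" by fact
  have K: "subgroup (K i) G" if "i \<in> {1..r}" for i using assms(9) that .
  have KG: "K i \<subseteq> carrier G" if "i \<in> {1..r}" for i using subgroup.subset[OF K[OF that]] .
  \<comment> \<open>\<open>Gsub\<close> is prescribed only below r; this extends it to i = r, where
    the subgroup is all of G.\<close>
  define L where "L i = (\<lambda>k. \<Otimes>\<^bsub>G\<^esub>j\<in>{1..i}. k j) ` (\<Pi>\<^sub>E j\<in>{1..i}. K j)" for i
  have L0: "L 0 = {\<one>\<^bsub>G\<^esub>}" by (simp add: L_def)
  have LSuc: "L (Suc i) = L i <#>\<^bsub>G\<^esub> K (Suc i)" if i: "Suc i \<le> r" for i
  proof -
    have ins: "{1..Suc i} = insert (Suc i) {1..i}" by auto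
    have prod: "finprod G (k(Suc i := y)) {1..Suc i} = (\<Otimes>\<^bsub>G\<^esub>j\<in>{1..i}. k j) \<otimes>\<^bsub>G\<^esub> y"
      if y: "y \<in> K (Suc i)" and k: "k \<in> (\<Pi>\<^sub>E j\<in>{1..i}. K j)" for y k
    proof -
      have yG: "y \<in> carrier G" using y KG[of "Suc i"] i by auto
      have kG: "k j \<in> carrier G" if "j \<in> {1..i}" for j
        using PiE_mem[OF k that] KG[of j] that i by auto
      have "finprod G (k(Suc i := y)) {1..Suc i} = y \<otimes>\<^bsub>G\<^esub> finprod G (k(Suc i := y)) {1..i}"
        unfolding ins using yG kG by (subst G.finprod_insert) auto
      also have "finprod G (k(Suc i := y)) {1..i} = (\<Otimes>\<^bsub>G\<^esub>j\<in>{1..i}. k j)"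
        using kG by (intro G.finprod_cong') auto
      also have "y \<otimes>\<^bsub>G\<^esub> (\<Otimes>\<^bsub>G\<^esub>j\<in>{1..i}. k j) = (\<Otimes>\<^bsub>G\<^esub>j\<in>{1..i}. k j) \<otimes>\<^bsub>G\<^esub> y"
        using yG kG by (intro G.m_comm G.finprod_closed) auto
      finally show ?thesis .
    qed
    \<comment> \<open>Families on {1..i+1} are those on {1..i} updated by a last entry y, whose
      product splits off y.\<close>
    have "L (Suc i) = (\<lambda>(y, k). finprod G (k(Suc i := y)) {1..Suc i}) ` (K (Suc i) \<times> (\<Pi>\<^sub>E j\<in>{1..i}. K j))"
      unfolding L_def ins PiE_insert_eq by (simp add: image_image case_prod_beta)
    also have "\<dots> = (\<lambda>(y, k). (\<Otimes>\<^bsub>G\<^esub>j\<in>{1..i}. k j) \<otimes>\<^bsub>G\<^esub> y) ` (K (Suc i) \<times> (\<Pi>\<^sub>E j\<in>{1..i}. K j))"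
      by (intro image_cong refl) (use prod in auto)
    also have "\<dots> = L i <#>\<^bsub>G\<^esub> K (Suc i)"
      unfolding L_def set_mult_def by auto
    finally show ?thesis .
  qed
  have L: "subgroup (L i) G" if "i \<le> r" for i
    using that
  proof (induction i)
    case 0
    show ?case using G.triv_subgroup by (simp add: L0)
  next
    case (Suc i)
    then show ?case using G.mult_subgroups[of "L i" "K (Suc i)"] K[of "Suc i"] by (simp add: LSuc)
  qed
  have inj: "inj_on (\<lambda>k. \<Otimes>\<^bsub>G\<^esub>i\<in>{1..r}. k i) (\<Pi>\<^sub>E i\<in>{1..r}. K i)"
    and surj: "(\<lambda>k. \<Otimes>\<^bsub>G\<^esub>i\<in>{1..r}. k i) ` (\<Pi>\<^sub>E i\<in>{1..r}. K i) = carrier G"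
    using assms(10) by (auto simp: iso_def bij_betw_def)
  have Lr: "L r = carrier G" using surj by (simp add: L_def)
  have LK: "L i \<inter> K (Suc i) = {\<one>\<^bsub>G\<^esub>}" if i: "Suc i \<le> r" for i
  proof -
    have "x = \<one>\<^bsub>G\<^esub>" if x: "x \<in> L i" "x \<in> K (Suc i)" for x
    proof -
      obtain k where k: "k \<in> (\<Pi>\<^sub>E j\<in>{1..i}. K j)" "x = (\<Otimes>\<^bsub>G\<^esub>j\<in>{1..i}. k j)"
        using x(1) by (auto simp: L_def)
      \<comment> \<open>Two families with the same product x: \<open>f\<close> pads k with ones,
        \<open>f'\<close> has x in place i + 1 and ones elsewhere. Injectivity makes them equal, and
        place i + 1 gives x = 1.\<close>
      define f where "f = (\<lambda>j\<in>{1..r}. if j \<le> i then k j else \<one>\<^bsub>G\<^esub>)"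
      define f' where "f' = (\<lambda>j\<in>{1..r}. if j = Suc i then x else \<one>\<^bsub>G\<^esub>)"
      have kK: "k j \<in> K j" if "j \<in> {1..i}" for j using PiE_mem[OF k(1) that] .
      have xG: "x \<in> carrier G" using x KG[of "Suc i"] i by auto
      have one: "\<one>\<^bsub>G\<^esub> \<in> K j" if "j \<in> {1..r}" for j using subgroup.one_closed[OF K[OF that]] .
      have f: "f \<in> (\<Pi>\<^sub>E j\<in>{1..r}. K j)" and f': "f' \<in> (\<Pi>\<^sub>E j\<in>{1..r}. K j)"
        using kK one x(2) by (auto simp: f_def f'_def)
      have "(\<Otimes>\<^bsub>G\<^esub>j\<in>{1..r}. f j) = (\<Otimes>\<^bsub>G\<^esub>j\<in>{1..i}. k j)"
        using i kK KG by (intro G.finprod_mono_neutral_cong_right) (auto simp: f_def subset_eq)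
      moreover have "(\<Otimes>\<^bsub>G\<^esub>j\<in>{1..r}. f' j) = (\<Otimes>\<^bsub>G\<^esub>j\<in>{1..r}. if Suc i = j then x else \<one>\<^bsub>G\<^esub>)"
        using xG by (intro G.finprod_cong') (auto simp: f'_def)
      moreover have "\<dots> = x"
        using i xG by (intro G.finprod_singleton) auto
      ultimately have "f = f'" using inj_onD[OF inj _ f f'] k(2) by simp
      then have "f (Suc i) = f' (Suc i)" by simp
      then show "x = \<one>\<^bsub>G\<^esub>" using i by (simp add: f_def f'_def)
    qed
    moreover have "\<one>\<^bsub>G\<^esub> \<in> L i" "\<one>\<^bsub>G\<^esub> \<in> K (Suc i)"
      using i by (auto intro!: subgroup.one_closed L K)
    ultimately show ?thesis by blast
  qed
  have main: "card (carrier M) = (\<Prod>\<psi>\<in>chars (L i). card (iso_part (L i) \<psi> M)) \<and>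
      (\<forall>\<psi>\<in>chars (L i). iso_part (L i) \<psi> M = smult_im M (norm_elt (L i) \<psi>))" if "i \<le> r" for i
    using that
  proof (induction i)
    case 0
    show ?case using trivial_decomposition[OF M] by (simp add: L0)
  next
    case (Suc i)
    let ?K = "K (Suc i)" and ?H = "H (Suc i)" and ?p = "p (Suc i)"
    have ir: "Suc i \<in> {1..r}" "i < r" using Suc.prems by auto
    have LG: "L i \<subseteq> carrier G" using subgroup.subset[OF L[of i]] ir by simp
    have H: "subgroup ?H G" "?H \<subseteq> ?K" "card ?H = ?p" using assms(16)[OF ir(1)] by auto
    obtain n where n: "card ?K = ?p ^ n" using assms(14)[OF ir(1)] by blast
    \<comment> \<open>Nontriviality of the factor lets one p be split off, giving the shape p^k * p
      required by the cyclic case.\<close>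
    have "n \<noteq> 0"
    proof
      assume "n = 0"
      then obtain x where "?K = {x}" using n by (metis card_1_singletonE power_0)
      then show False using subgroup.one_closed[OF K[OF ir(1)]] assms(13)[OF ir(1)] by auto
    qed
    then obtain k where k: "card ?K = ?p ^ k * ?p" using n by (metis not0_implies_Suc power_Suc2)
    obtain g where g: "cyclic_enum G ?K g (?p ^ k * ?p)"
      using G.ex_cyclic_enum[OF fin K[OF ir(1)] assms(12)[OF ir(1)]] k by auto
    have decomposition:
      "card (iso_part (L i) \<psi> M) = (\<Prod>\<chi>\<in>chars ?K. card (iso_part ?K \<chi> (M\<lparr>carrier := iso_part (L i) \<psi> M\<rparr>)))"
      "\<And>\<chi>. \<chi> \<in> chars ?K \<Longrightarrow> iso_part ?K \<chi> (M\<lparr>carrier := iso_part (L i) \<psi> M\<rparr>)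
        = smult_im (M\<lparr>carrier := iso_part (L i) \<psi> M\<rparr>) (norm_elt ?K \<chi>)"
      if \<psi>: "\<psi> \<in> chars (L i)" for \<psi>
    proof -
      let ?N = "M\<lparr>carrier := iso_part (L i) \<psi> M\<rparr>"
      have N: "module S ?N" by (rule isotypic_module[OF M \<psi> LG])
      have finN: "finite (carrier ?N)"
        using finite_subset[OF _ assms(8), of "iso_part (L i) \<psi> M"] by (auto simp: isotypic_def)
      \<comment> \<open>The vanishing hypothesis at index i + 1 concerns \<open>Gsub i\<close>,
        exactly the subgroup reached so far.\<close>
      have Gsub: "Gsub i = L i" using assms(15)[OF ir(2)] by (simp add: L_def)
      have vanish: "iso_part ?H \<chi> ?N \<subseteq> smult_im ?N (norm_elt ?H \<chi>)" if \<chi>: "\<chi> \<in> chars ?H" for \<chi>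
        using vanish_hyp[OF ir(1) \<chi>, of \<psi>] \<psi> subgroup.subset[OF H(1)]
        by (intro trivial_tate_H0_imp[OF N \<chi>]) (simp_all add: Gsub)
      note cyclic = cyclic_decomposition[OF N finN K[OF ir(1)] g H]
      show "card (iso_part (L i) \<psi> M) = (\<Prod>\<chi>\<in>chars ?K. card (iso_part ?K \<chi> ?N))"
        using cyclic(1) vanish by simp
      show "iso_part ?K \<chi> ?N = smult_im ?N (norm_elt ?K \<chi>)" if "\<chi> \<in> chars ?K" for \<chi>
        by (rule cyclic(2)) (use vanish that in auto)
    qed
    have IH: "card (carrier M) = (\<Prod>\<psi>\<in>chars (L i). card (iso_part (L i) \<psi> M))"
      "\<And>\<psi>. \<psi> \<in> chars (L i) \<Longrightarrow> iso_part (L i) \<psi> M = smult_im M (norm_elt (L i) \<psi>)"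
      using Suc ir by auto
    have Li: "subgroup (L i) G" using L ir by simp
    note product = product_decomposition[OF M Li K[OF ir(1)] LK[OF Suc.prems] IH decomposition]
    show ?case unfolding LSuc[OF Suc.prems] using product by simp
  qed
  \<comment> \<open>At i = r the subgroup statements become statements about G; the second product
    agrees with the first factor by factor, since M^\<psi> = \<epsilon>_\<psi> M.\<close>
  have "G\<lparr>carrier := carrier G\<rparr> = G" by simp
  then show ?thesis
    using main[of r] char_sum_image_eq[of "carrier G" _ M] by (simp add: Lr)
qed

end
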